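(* For every biframe $\mathcal L$, the bijection $\alpha_{\mathcal L}:Sk(\mathsf{bpt}(\mathcal L))\cong\mathsf{bpt}(\mathsf A(\mathcal L))$ is a bihomeomorphism.
   Context: A biframe is a triple $\mathcal L=(L^+,L^-,L)$ of frames with injective frame maps $e_L^{\pm}:L^{\pm}\to L$ such that every element of $L$ (the main component) is a join of elements $e_L^+(x^+)\wedge e_L^-(x^-)$; we identify $x^{\pm}$ with $e_L^{\pm}(x^{\pm})$. A biframe map $(f^+,f^-):\mathcal L\to\mathcal M$ is a pair of frame maps $f^{\pm}:L^{\pm}\to M^{\pm}$ for which there is a (necessarily unique) frame map $f:L\to M$ with $f\circ e_L^{\pm}=e_M^{\pm}\circ f^{\pm}$. $\mathsf A(L)$ is the frame of congruences on $L$ ordered by inclusion; $\nabla(a)=\{(x,y):x\vee a=y\vee a\}$, $\Delta(a)=\{(x,y):x\wedge a=y\wedge a\}$; $\mathsf{fin}(L)\subseteq L$ is the set of finite joins of elements $x^+\wedge x^-$. The assembly $\mathsf A(\mathcal L)$ is the biframe (with inclusions as the two injections) whose positive, negative and main components are the subframes of $\mathsf A(L)$ generated respectively by $\{\nabla(a^+):a^+\in L^+\}\cup\{\Delta(a^-):a^-\in L^-\}$, by $\{\nabla(a^-):a^-\in L^-\}\cup\{\Delta(a^+):a^+\in L^+\}$, and by $\{\nabla(x):x\in L\}\cup\{\Delta(s):s\in\mathsf{fin}(L)\}$. $\nabla:\mathcal L\to\mathsf A(\mathcal L)$ is the biframe map $a^{\pm}\mapsto\nabla(a^{\pm})$. A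 bispace is a set with two topologies (positive and negative); a bihomeomorphism is a bijection that is a homeomorphism for both the positive and the negative topologies. $\mathsf{bpt}(\mathcal L)$ is the bispace of biframe maps $\mathcal L\to\mathbf 2=(2,2,2)$ with positive opens $\{f:f^+(a^+)=1\}$ ($a^+\in L^+$) and negative opens $\{f:f^-(a^-)=1\}$ ($a^-\in L^-$). $Sk(X)$ (Skula bispace) has the same points as $X$; its positive topology is generated by the positive opens and the negative closed sets of $X$, its negative topology by the negative opens and the positive closed sets of $X$. $\alpha_{\mathcal L}$ sends a biframe map $f:\mathcal L\to\mathbf 2$ to the unique biframe map $\tilde f:\mathsf A(\mathcal L)\to\mathbf 2$ with $\tilde f\circ\nabla=f$; it is a bijection between the underlying sets of $\mathsf{bpt}(\mathcal L)$ and $\mathsf{bpt}(\mathsf A(\mathcal L))$. *)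

theory Defs
  imports "HOL-Analysis.Analysis" "HOL-Algebra.Complete_Lattice"
begin

section \<open>Frames\<close>

locale frame = complete_lattice L for L (structure) +
  assumes meet_sup_distrib:
    "\<lbrakk>x \<in> carrier L; S \<subseteq> carrier L\<rbrakk> \<Longrightarrow> x \<sqinter> \<Squnion>S = \<Squnion>((\<lambda>s. x \<sqinter> s) ` S)"

text \<open>Preservation of the bottom element is the case of the empty join.\<close>

definition frame_map :: "'a gorder \<Rightarrow> 'b gorder \<Rightarrow> ('a \<Rightarrow> 'b) \<Rightarrow> bool" where
  "frame_map L M f \<longleftrightarrow>
     f \<in> carrier L \<rightarrow> carrier M \<and>
     (\<forall>S \<subseteq> carrier L. f (\<Squnion>\<^bsub>L\<^esub> S) = \<Squnion>\<^bsub>M\<^esub> (f ` S)) \<and>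
     f \<top>\<^bsub>L\<^esub> = \<top>\<^bsub>M\<^esub> \<and>
     (\<forall>x \<in> carrier L. \<forall>y \<in> carrier L. f (x \<sqinter>\<^bsub>L\<^esub> y) = f x \<sqinter>\<^bsub>M\<^esub> f y)"

text \<open>A subframe is given by its set of elements; as a frame it is
  \<open>F\<lparr>carrier := S\<rparr>\<close>.\<close>

definition subframe :: "'a gorder \<Rightarrow> 'a set \<Rightarrow> bool" where
  "subframe F S \<longleftrightarrow>
     S \<subseteq> carrier F \<and>
     (\<forall>T \<subseteq> S. \<Squnion>\<^bsub>F\<^esub> T \<in> S) \<and>
     \<top>\<^bsub>F\<^esub> \<in> S \<and>
     (\<forall>x \<in> S. \<forall>y \<in> S. x \<sqinter>\<^bsub>F\<^esub> y \<in> S)"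

definition generated_subframe :: "'a gorder \<Rightarrow> 'a set \<Rightarrow> 'a gorder" where
  "generated_subframe F G = F\<lparr>carrier := subframe F hull G\<rparr>"

definition two :: "bool gorder" where
  "two = \<lparr>carrier = UNIV, eq = (=), le = (\<le>)\<rparr>"

section \<open>Biframes\<close>

record ('p, 'n, 'a) biframe =
  Pos :: "'p gorder"
  Neg :: "'n gorder"
  Main :: "'a gorder"
  emb_pos :: "'p \<Rightarrow> 'a"
  emb_neg :: "'n \<Rightarrow> 'a"

definition rectangles :: "('p, 'n, 'a) biframe \<Rightarrow> 'a set" where
  "rectangles L =
     {emb_pos L x \<sqinter>\<^bsub>Main L\<^esub> emb_neg L y | x y. x \<in> carrier (Pos L) \<and> y \<in> carrier (Neg L)}"

definition is_biframe :: "('p, 'n, 'a) biframe \<Rightarrow> bool" where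
  "is_biframe L \<longleftrightarrow>
     frame (Pos L) \<and> frame (Neg L) \<and> frame (Main L) \<and>
     frame_map (Pos L) (Main L) (emb_pos L) \<and> inj_on (emb_pos L) (carrier (Pos L)) \<and>
     frame_map (Neg L) (Main L) (emb_neg L) \<and> inj_on (emb_neg L) (carrier (Neg L)) \<and>
     (\<forall>z \<in> carrier (Main L). \<exists>S \<subseteq> rectangles L. z = \<Squnion>\<^bsub>Main L\<^esub> S)"

text \<open>Both components of a biframe map are required to be extensional, so that equality of biframe
  maps in HOL means agreement on the carriers.\<close>

definition biframe_maps ::
  "('p, 'n, 'a) biframe \<Rightarrow> ('q, 'm, 'b) biframe \<Rightarrow> (('p \<Rightarrow> 'q) \<times> ('n \<Rightarrow> 'm)) set" where
  "biframe_maps L M =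
     {(fp, fn).
        frame_map (Pos L) (Pos M) fp \<and> fp \<in> extensional (carrier (Pos L)) \<and>
        frame_map (Neg L) (Neg M) fn \<and> fn \<in> extensional (carrier (Neg L)) \<and>
        (\<exists>f. frame_map (Main L) (Main M) f \<and>
             (\<forall>x \<in> carrier (Pos L). f (emb_pos L x) = emb_pos M (fp x)) \<and>
             (\<forall>y \<in> carrier (Neg L). f (emb_neg L y) = emb_neg M (fn y)))}"

definition biframe_comp ::
  "('p, 'n, 'a) biframe \<Rightarrow> ('q \<Rightarrow> 'r) \<times> ('m \<Rightarrow> 'k) \<Rightarrow> ('p \<Rightarrow> 'q) \<times> ('n \<Rightarrow> 'm)
     \<Rightarrow> ('p \<Rightarrow> 'r) \<times> ('n \<Rightarrow> 'k)" where
  "biframe_comp L g f =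
     (compose (carrier (Pos L)) (fst g) (fst f), compose (carrier (Neg L)) (snd g) (snd f))"

definition two_biframe :: "(bool, bool, bool) biframe" where
  "two_biframe = \<lparr>Pos = two, Neg = two, Main = two, emb_pos = id, emb_neg = id\<rparr>"

section \<open>The assembly\<close>

text \<open>A subset of a congruence encodes a family of related pairs, so quantifying over \<open>R \<subseteq> \<theta>\<close>
  expresses compatibility with arbitrary joins.\<close>

definition congruence :: "'a gorder \<Rightarrow> ('a \<times> 'a) set \<Rightarrow> bool" where
  "congruence L \<theta> \<longleftrightarrow>
     equiv (carrier L) \<theta> \<and>
     (\<forall>R \<subseteq> \<theta>. (\<Squnion>\<^bsub>L\<^esub> (fst ` R), \<Squnion>\<^bsub>L\<^esub> (snd ` R)) \<in> \<theta>) \<and>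
     (\<forall>(x, y) \<in> \<theta>. \<forall>(x', y') \<in> \<theta>. (x \<sqinter>\<^bsub>L\<^esub> x', y \<sqinter>\<^bsub>L\<^esub> y') \<in> \<theta>)"

definition congruence_frame :: "'a gorder \<Rightarrow> ('a \<times> 'a) set gorder" where
  "congruence_frame L = \<lparr>carrier = {\<theta>. congruence L \<theta>}, eq = (=), le = (\<subseteq>)\<rparr>"

definition nabla :: "'a gorder \<Rightarrow> 'a \<Rightarrow> ('a \<times> 'a) set" where
  "nabla L a = {(x, y) \<in> carrier L \<times> carrier L. x \<squnion>\<^bsub>L\<^esub> a = y \<squnion>\<^bsub>L\<^esub> a}"

definition delta :: "'a gorder \<Rightarrow> 'a \<Rightarrow> ('a \<times> 'a) set" where
  "delta L a = {(x, y) \<in> carrier L \<times> carrier L. x \<sqinter>\<^bsub>L\<^esub> a = y \<sqinter>\<^bsub>L\<^esub> a}"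

definition fin_elements :: "('p, 'n, 'a) biframe \<Rightarrow> 'a set" where
  "fin_elements L = {\<Squnion>\<^bsub>Main L\<^esub> F | F. finite F \<and> F \<subseteq> rectangles L}"

definition assembly ::
  "('p, 'n, 'a) biframe \<Rightarrow> (('a \<times> 'a) set, ('a \<times> 'a) set, ('a \<times> 'a) set) biframe" where
  "assembly L =
     (let M = Main L; C = congruence_frame M;
          P = emb_pos L ` carrier (Pos L); N = emb_neg L ` carrier (Neg L)
      in \<lparr>Pos = generated_subframe C (nabla M ` P \<union> delta M ` N),
          Neg = generated_subframe C (nabla M ` N \<union> delta M ` P),
          Main = generated_subframe C (nabla M ` carrier M \<union> delta M ` fin_elements L),
          emb_pos = id, emb_neg = id\<rparr>)"

definition nabla_map ::
  "('p, 'n, 'a) biframe \<Rightarrow> ('p \<Rightarrow> ('a \<times> 'a) set) \<times> ('n \<Rightarrow> ('a \<times> 'a) set)" where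
  "nabla_map L =
     (\<lambda>a \<in> carrier (Pos L). nabla (Main L) (emb_pos L a),
      \<lambda>a \<in> carrier (Neg L). nabla (Main L) (emb_neg L a))"

section \<open>Bispaces\<close>

record 'a bispace =
  points :: "'a set"
  pos_top :: "'a topology"
  neg_top :: "'a topology"

definition is_bispace :: "'a bispace \<Rightarrow> bool" where
  "is_bispace X \<longleftrightarrow> topspace (pos_top X) = points X \<and> topspace (neg_top X) = points X"

definition bihomeomorphism :: "'a bispace \<Rightarrow> 'b bispace \<Rightarrow> ('a \<Rightarrow> 'b) \<Rightarrow> bool" where
  "bihomeomorphism X Y f \<longleftrightarrow>
     bij_betw f (points X) (points Y) \<and>
     homeomorphic_map (pos_top X) (pos_top Y) f \<and>
     homeomorphic_map (neg_top X) (neg_top Y) f"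

definition Skula :: "'a bispace \<Rightarrow> 'a bispace" where
  "Skula X =
     \<lparr>points = points X,
      pos_top = topology_generated_by ({U. openin (pos_top X) U} \<union> {C. closedin (neg_top X) C}),
      neg_top = topology_generated_by ({U. openin (neg_top X) U} \<union> {C. closedin (pos_top X) C})\<rparr>"

lemma is_bispace_Skula: "is_bispace X \<Longrightarrow> is_bispace (Skula X)"
proof -
  assume X: "is_bispace X"
  then have "\<Union>({U. openin (pos_top X) U} \<union> {C. closedin (neg_top X) C}) = points X"
    and "\<Union>({U. openin (neg_top X) U} \<union> {C. closedin (pos_top X) C}) = points X"
    using openin_subset[of "pos_top X"] closedin_subset[of "neg_top X"]
      openin_subset[of "neg_top X"] closedin_subset[of "pos_top X"]
      openin_topspace[of "pos_top X"] openin_topspace[of "neg_top X"]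
    unfolding is_bispace_def by (intro equalityI; force)+
  then show ?thesis
    by (simp add: is_bispace_def Skula_def topology_generated_by_topspace)
qed

text \<open>Since \<open>two\<close> is carried by the booleans, \<open>fst f a\<close> says that the positive component of \<open>f\<close>
  sends \<open>a\<close> to 1.\<close>

definition bpt :: "('p, 'n, 'a) biframe \<Rightarrow> (('p \<Rightarrow> bool) \<times> ('n \<Rightarrow> bool)) bispace" where
  "bpt L =
     (let X = biframe_maps L two_biframe
      in \<lparr>points = X,
          pos_top = topology (\<lambda>U. \<exists>a \<in> carrier (Pos L). U = {f \<in> X. fst f a}),
          neg_top = topology (\<lambda>U. \<exists>a \<in> carrier (Neg L). U = {f \<in> X. snd f a})\<rparr>)"

definition alpha ::
  "('p, 'n, 'a) biframe \<Rightarrow> ('p \<Rightarrow> bool) \<times> ('n \<Rightarrow> bool)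
     \<Rightarrow> (('a \<times> 'a) set \<Rightarrow> bool) \<times> (('a \<times> 'a) set \<Rightarrow> bool)" where
  "alpha L f =
     (THE g. g \<in> biframe_maps (assembly L) two_biframe \<and> biframe_comp L g (nabla_map L) = f)"

text \<open>The sets declared open in \<^const>\<open>bpt\<close> do form topologies.\<close>

lemma two_Sup: "\<Squnion>\<^bsub>two\<^esub> S \<longleftrightarrow> True \<in> S"
proof -
  have "least two (\<Squnion>\<^bsub>two\<^esub> S) (Upper two S)"
    unfolding Lattice.sup_def
    by (rule someI[of _ "True \<in> S"]) (auto simp: least_def Upper_def two_def)
  then have "\<forall>s. s \<in> S \<longrightarrow> s \<longrightarrow> \<Squnion>\<^bsub>two\<^esub> S"
    and "\<forall>y. (\<forall>s. s \<in> S \<longrightarrow> s \<longrightarrow> y) \<longrightarrow> \<Squnion>\<^bsub>two\<^esub> S \<longrightarrow> y"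
    by (simp_all add: least_def Upper_def two_def Ball_def) blast
  then show ?thesis
    by (metis (full_types))
qed

lemma two_meet: "x \<sqinter>\<^bsub>two\<^esub> y \<longleftrightarrow> x \<and> y"
proof -
  have "greatest two (x \<sqinter>\<^bsub>two\<^esub> y) (Lower two {x, y})"
    unfolding meet_def Lattice.inf_def
    by (rule someI[of _ "x \<and> y"]) (auto simp: greatest_def Lower_def two_def)
  then show ?thesis
    by (auto simp: greatest_def Lower_def two_def)
qed

lemma two_top: "\<top>\<^bsub>two\<^esub>"
proof -
  have "greatest two \<top>\<^bsub>two\<^esub> (carrier two)"
    unfolding Order.top_def
    by (rule someI[of _ True]) (auto simp: greatest_def two_def)
  then show ?thesis
    by (auto simp: greatest_def two_def)
qed

lemma istopology_spectrum:
  assumes "frame L" and hom: "\<And>f. f \<in> X \<Longrightarrow> frame_map L two (\<pi> f)"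
  shows "istopology (\<lambda>U. \<exists>a \<in> carrier L. U = {f \<in> X. \<pi> f a})" (is "istopology ?P")
proof -
  interpret frame L by fact
  have "?P (U \<inter> V)" if "?P U" "?P V" for U V
  proof -
    from that obtain a b where ab: "a \<in> carrier L" "b \<in> carrier L"
      and UV: "U = {f \<in> X. \<pi> f a}" "V = {f \<in> X. \<pi> f b}" by auto
    have "\<pi> f (a \<sqinter>\<^bsub>L\<^esub> b) \<longleftrightarrow> \<pi> f a \<and> \<pi> f b" if "f \<in> X" for f
      using hom[OF that] ab by (simp add: frame_map_def two_meet)
    then have "U \<inter> V = {f \<in> X. \<pi> f (a \<sqinter>\<^bsub>L\<^esub> b)}" using UV by auto
    then show ?thesis using ab by (auto intro!: bexI[of _ "a \<sqinter>\<^bsub>L\<^esub> b"])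
  qed
  moreover have "?P (\<Union>\<K>)" if "\<forall>K \<in> \<K>. ?P K" for \<K>
  proof -
    define S where "S = {a \<in> carrier L. {f \<in> X. \<pi> f a} \<in> \<K>}"
    have S: "S \<subseteq> carrier L" by (auto simp: S_def)
    have "\<pi> f (\<Squnion>\<^bsub>L\<^esub> S) \<longleftrightarrow> (\<exists>a \<in> S. \<pi> f a)" if "f \<in> X" for f
      using hom[OF that] S by (auto simp: frame_map_def two_Sup)
    moreover have "\<Union>\<K> = {f \<in> X. \<exists>a \<in> S. \<pi> f a}"
    proof (rule Set.set_eqI)
      fix f
      show "f \<in> \<Union>\<K> \<longleftrightarrow> f \<in> {f \<in> X. \<exists>a \<in> S. \<pi> f a}"
      proof
        assume "f \<in> \<Union>\<K>"
        then obtain K where K: "K \<in> \<K>" "f \<in> K" by blast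
        with that obtain a where "a \<in> carrier L" "K = {f \<in> X. \<pi> f a}" by blast
        with K show "f \<in> {f \<in> X. \<exists>a \<in> S. \<pi> f a}" unfolding S_def by blast
      next
        assume "f \<in> {f \<in> X. \<exists>a \<in> S. \<pi> f a}"
        then obtain a where "{f \<in> X. \<pi> f a} \<in> \<K>" "f \<in> {f \<in> X. \<pi> f a}"
          unfolding S_def by blast
        then show "f \<in> \<Union>\<K>" by (rule UnionI)
      qed
    qed
    ultimately have "\<Union>\<K> = {f \<in> X. \<pi> f (\<Squnion>\<^bsub>L\<^esub> S)}" by auto
    then show ?thesis using S by (auto intro!: bexI[of _ "\<Squnion>\<^bsub>L\<^esub> S"] sup_closed)
  qed
  ultimately show ?thesis unfolding istopology_def by blast
qed

lemma openin_bpt: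
  assumes "is_biframe L"
  shows "openin (pos_top (bpt L)) U \<longleftrightarrow> (\<exists>a \<in> carrier (Pos L). U = {f \<in> points (bpt L). fst f a})"
    and "openin (neg_top (bpt L)) U \<longleftrightarrow> (\<exists>a \<in> carrier (Neg L). U = {f \<in> points (bpt L). snd f a})"
proof -
  let ?X = "biframe_maps L two_biframe"
  have fr: "frame (Pos L)" "frame (Neg L)"
    using assms by (auto simp: is_biframe_def)
  have hom: "frame_map (Pos L) two (fst f)" "frame_map (Neg L) two (snd f)" if "f \<in> ?X" for f
    using that by (auto simp: biframe_maps_def two_biframe_def)
  show "openin (pos_top (bpt L)) U \<longleftrightarrow> (\<exists>a \<in> carrier (Pos L). U = {f \<in> points (bpt L). fst f a})"
    using topology_inverse'[OF istopology_spectrum[where \<pi> = fst, OF fr(1) hom(1)]]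
    by (simp add: bpt_def Let_def)
  show "openin (neg_top (bpt L)) U \<longleftrightarrow> (\<exists>a \<in> carrier (Neg L). U = {f \<in> points (bpt L). snd f a})"
    using topology_inverse'[OF istopology_spectrum[where \<pi> = snd, OF fr(2) hom(2)]]
    by (simp add: bpt_def Let_def)
qed

lemma is_bispace_bpt:
  assumes "is_biframe L"
  shows "is_bispace (bpt L)"
proof -
  interpret P: frame "Pos L" using assms by (simp add: is_biframe_def)
  interpret N: frame "Neg L" using assms by (simp add: is_biframe_def)
  have *: "fst f \<top>\<^bsub>Pos L\<^esub>" "snd f \<top>\<^bsub>Neg L\<^esub>" if "f \<in> points (bpt L)" for f
    using that by (auto simp: bpt_def Let_def biframe_maps_def two_biframe_def frame_map_def two_top)
  have "openin (pos_top (bpt L)) (points (bpt L))"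
    unfolding openin_bpt[OF assms] using *(1) by (intro bexI[of _ "\<top>\<^bsub>Pos L\<^esub>"]) (blast, simp)
  moreover have "openin (neg_top (bpt L)) (points (bpt L))"
    unfolding openin_bpt[OF assms] using *(2) by (intro bexI[of _ "\<top>\<^bsub>Neg L\<^esub>"]) (blast, simp)
  moreover have "topspace (pos_top (bpt L)) \<subseteq> points (bpt L)"
    "topspace (neg_top (bpt L)) \<subseteq> points (bpt L)"
    unfolding topspace_def openin_bpt[OF assms] by auto
  ultimately show ?thesis
    unfolding is_bispace_def by (meson openin_subset subset_antisym)
qed

end

theory Submission
  imports Defs
begin

text \<open>
  A point \<open>f\<close> of \<open>L\<close>, with main component \<open>h\<close>, extends to the assembly by sending a congruence
  \<open>\<theta>\<close> to 1 iff \<open>\<theta>\<close> is not contained in the kernel of \<open>h\<close>; this preserves joins because the kernel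
  is itself a congruence, and binary meets because the kernel is prime. The extension is unique since
  \<open>\<nabla>(a)\<close> and \<open>\<Delta>(a)\<close> are complements, so a point of the assembly is determined on the generators by
  its restriction along \<open>\<nabla>\<close>. Under the resulting bijection the generators \<open>\<nabla>(a\<^sup>+)\<close> and \<open>\<Delta>(a\<^sup>-)\<close>
  correspond exactly to the positive opens and the negative closed sets, which generate the positive
  Skula topology.
\<close>

section \<open>Frames and their subframes\<close>

text \<open>The obstacle is that complementation crosses the two sides: \<open>delta\<close> of a
  negative element is a positive generator, while its complement, \<open>nabla\<close> of the same
  element, is a negative one. Neither \<open>fst g\<close> nor \<open>snd g\<close> alone relates
  the two values; only the main map restricting to both does, and for this the images of both sides
  must lie in \<open>fin_elements L\<close>, so that their \<open>delta\<close> belongs to the main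
  component. For the same reason the extension of a point is built from the kernel of its main
  component \<open>h\<close>: a single predicate on the congruences of \<open>Main L\<close>
  restricts to all three components, so the two sides are compatible at once. Joins of congruences
  get no explicit formula; they enter through their universal property, against which non-inclusion
  in a fixed kernel is easy to test. On the topological side, the elements of a hull whose point set
  is Skula-open form a subframe, so testing the generators is enough.\<close>

context frame
begin

lemma join_le_iff:
  assumes "x \<in> carrier L" "y \<in> carrier L" "z \<in> carrier L"
  shows "x \<squnion> y \<sqsubseteq> z \<longleftrightarrow> x \<sqsubseteq> z \<and> y \<sqsubseteq> z"
  using assms le_trans[OF join_left[of x y]] le_trans[OF join_right[of x y]] join_le by auto

lemma le_meet_iff:
  assumes "x \<in> carrier L" "y \<in> carrier L" "z \<in> carrier L"
  shows "z \<sqsubseteq> x \<sqinter> y \<longleftrightarrow> z \<sqsubseteq> x \<and> z \<sqsubseteq> y"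
  using assms le_trans[OF _ meet_left[of x y]] le_trans[OF _ meet_right[of x y]] meet_le by auto

lemma Sup_le_iff:
  assumes "A \<subseteq> carrier L" "z \<in> carrier L"
  shows "\<Squnion>A \<sqsubseteq> z \<longleftrightarrow> (\<forall>x\<in>A. x \<sqsubseteq> z)"
  using assms le_trans[OF sup_upper[of A]] sup_least[of A z] by auto

lemma le_join1: "\<lbrakk>x \<sqsubseteq> y; x \<in> carrier L; y \<in> carrier L; z \<in> carrier L\<rbrakk> \<Longrightarrow> x \<sqsubseteq> y \<squnion> z"
  by (rule le_trans[OF _ join_left]) auto

lemma le_join2: "\<lbrakk>x \<sqsubseteq> z; x \<in> carrier L; y \<in> carrier L; z \<in> carrier L\<rbrakk> \<Longrightarrow> x \<sqsubseteq> y \<squnion> z"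
  by (rule le_trans[OF _ join_right]) auto

lemma bottom_join_eq: "x \<in> carrier L \<Longrightarrow> \<bottom> \<squnion> x = x"
  using bottom_join[of x] by (simp add: eq_is_equal)

lemma top_meet_eq: "x \<in> carrier L \<Longrightarrow> \<top> \<sqinter> x = x"
  using top_meet[of x] by (simp add: eq_is_equal)

lemma meet_join_distrib:
  assumes "x \<in> carrier L" "y \<in> carrier L" "z \<in> carrier L"
  shows "x \<sqinter> (y \<squnion> z) = (x \<sqinter> y) \<squnion> (x \<sqinter> z)"
  using meet_sup_distrib[of x "{y, z}"] assms by (simp add: join_def)

text \<open>The dual distributive law follows from the binary case of the frame law. It is what
  makes \<open>nabla\<close>, defined through joins, compatible with binary meets.\<close>

lemma join_meet_distrib:
  assumes "x \<in> carrier L" "y \<in> carrier L" "z \<in> carrier L"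
  shows "x \<squnion> (y \<sqinter> z) = (x \<squnion> y) \<sqinter> (x \<squnion> z)"
proof (rule le_antisym)
  have "(x \<squnion> y) \<sqinter> (x \<squnion> z) = ((x \<squnion> y) \<sqinter> x) \<squnion> ((x \<squnion> y) \<sqinter> z)"
    using assms by (simp add: meet_join_distrib)
  also have "(x \<squnion> y) \<sqinter> z = (z \<sqinter> x) \<squnion> (z \<sqinter> y)"
    using assms by (simp add: meet_join_distrib meet_comm[of L _ z])
  also have "((x \<squnion> y) \<sqinter> x) \<squnion> \<dots> \<sqsubseteq> x \<squnion> (y \<sqinter> z)"
  proof -
    have "z \<sqinter> y \<sqsubseteq> x \<squnion> (y \<sqinter> z)"
      using assms by (simp add: meet_comm[of L z] join_right)
    moreover have "(x \<squnion> y) \<sqinter> x \<sqsubseteq> x \<squnion> (y \<sqinter> z)" "z \<sqinter> x \<sqsubseteq> x \<squnion> (y \<sqinter> z)"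
      using assms by (simp_all add: le_join1 meet_right)
    ultimately show ?thesis using assms by (simp add: join_le_iff)
  qed
  finally show "(x \<squnion> y) \<sqinter> (x \<squnion> z) \<sqsubseteq> x \<squnion> (y \<sqinter> z)" .
  have "x \<sqsubseteq> x \<squnion> y" "x \<sqsubseteq> x \<squnion> z" "y \<sqinter> z \<sqsubseteq> x \<squnion> y" "y \<sqinter> z \<sqsubseteq> x \<squnion> z"
    using assms by (simp_all add: le_join1 le_join2 join_left meet_left meet_right)
  then show "x \<squnion> (y \<sqinter> z) \<sqsubseteq> (x \<squnion> y) \<sqinter> (x \<squnion> z)"
    using assms by (simp add: join_le_iff le_meet_iff)
qed (use assms in auto)

lemma meet_meet_distrib:
  assumes "x \<in> carrier L" "y \<in> carrier L" "a \<in> carrier L"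
  shows "(x \<sqinter> y) \<sqinter> a = (x \<sqinter> a) \<sqinter> (y \<sqinter> a)"
proof (rule le_antisym)
  have "x \<sqinter> y \<sqinter> a \<sqsubseteq> x \<sqinter> y" "x \<sqinter> y \<sqinter> a \<sqsubseteq> a"
    using assms by (simp_all add: meet_left meet_right)
  then show "x \<sqinter> y \<sqinter> a \<sqsubseteq> (x \<sqinter> a) \<sqinter> (y \<sqinter> a)"
    using assms by (simp add: le_meet_iff)
  have "(x \<sqinter> a) \<sqinter> (y \<sqinter> a) \<sqsubseteq> x \<sqinter> a" "(x \<sqinter> a) \<sqinter> (y \<sqinter> a) \<sqsubseteq> y \<sqinter> a"
    using assms by (simp_all add: meet_left meet_right)
  then show "(x \<sqinter> a) \<sqinter> (y \<sqinter> a) \<sqsubseteq> x \<sqinter> y \<sqinter> a"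
    using assms by (simp add: le_meet_iff)
qed (use assms in auto)

text \<open>Cancellation in a distributive lattice. It says that only equal elements are related by
  both \<open>nabla L a\<close> and \<open>delta L a\<close>.\<close>

lemma join_meet_cancel:
  assumes "x \<in> carrier L" "y \<in> carrier L" "a \<in> carrier L"
    and "x \<squnion> a = y \<squnion> a" "x \<sqinter> a = y \<sqinter> a"
  shows "x = y"
proof -
  have le: "u \<sqsubseteq> v" if "u \<in> carrier L" "v \<in> carrier L" "u \<squnion> a = v \<squnion> a" "u \<sqinter> a = v \<sqinter> a" for u v
  proof -
    \<comment> \<open>Here \<open>u\<close> lies below \<open>u \<squnion> a\<close>, which equals
      \<open>v \<squnion> a\<close>; after distributing, \<open>u \<sqinter> a\<close> is exchanged
      for \<open>v \<sqinter> a\<close>.\<close>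
    have "u = u \<sqinter> (v \<squnion> a)"
      using that assms(3) le_iff_join[of u "u \<squnion> a"] join_left[of u a] by simp
    also have "\<dots> = (u \<sqinter> v) \<squnion> (v \<sqinter> a)"
      using that assms(3) by (simp add: meet_join_distrib)
    also have "\<dots> \<sqsubseteq> v"
      using that assms(3) by (simp add: join_le_iff meet_left meet_right)
    finally show ?thesis .
  qed
  show ?thesis by (rule le_antisym) (use le assms in auto)
qed

end

text \<open>A point read as a completely prime filter. The case of empty \<open>S\<close> says that
  the empty join is sent to \<open>False\<close>.\<close>

lemma frame_map_two:
  "frame_map L two f \<longleftrightarrow>
     (\<forall>S \<subseteq> carrier L. f (\<Squnion>\<^bsub>L\<^esub> S) \<longleftrightarrow> (\<exists>x\<in>S. f x)) \<and> f \<top>\<^bsub>L\<^esub> \<and>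
     (\<forall>x \<in> carrier L. \<forall>y \<in> carrier L. f (x \<sqinter>\<^bsub>L\<^esub> y) \<longleftrightarrow> f x \<and> f y)"
proof -
  have "carrier two = UNIV" by (simp add: two_def)
  moreover have "True \<in> f ` S \<longleftrightarrow> (\<exists>x\<in>S. f x)" for S by auto
  ultimately show ?thesis by (simp add: frame_map_def two_Sup two_top two_meet)
qed

lemma frame_map_two_join:
  assumes "frame_map L two f" "x \<in> carrier L" "y \<in> carrier L"
  shows "f (x \<squnion>\<^bsub>L\<^esub> y) \<longleftrightarrow> f x \<or> f y"
  using assms by (auto simp: frame_map_two join_def)

text \<open>Subframes are closed under intersection. The condition on \<open>G\<close> makes
  \<open>carrier F\<close> one of the subframes intersected; an intersection over no sets would be
  the whole type.\<close>

lemma subframe_hull: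
  assumes "complete_lattice F" "G \<subseteq> carrier F"
  shows "subframe F (subframe F hull G)"
proof -
  interpret complete_lattice F by fact
  have "subframe F (carrier F)" by (auto simp: subframe_def)
  then have "subframe F hull G \<subseteq> carrier F" using assms(2) by (rule hull_minimal[rotated])
  moreover have "\<Squnion>\<^bsub>F\<^esub> T \<in> subframe F hull G" if "T \<subseteq> subframe F hull G" for T
    using that unfolding hull_def subframe_def by (simp add: subset_iff)
  moreover have "\<top>\<^bsub>F\<^esub> \<in> subframe F hull G" "\<forall>x\<in>subframe F hull G. \<forall>y\<in>subframe F hull G. x \<sqinter>\<^bsub>F\<^esub> y \<in> subframe F hull G"
    unfolding hull_def subframe_def by blast+
  ultimately show ?thesis
    unfolding subframe_def[of F "subframe F hull G"] by blast
qed

context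
  fixes F :: "'a gorder" and S :: "'a set"
  assumes F: "complete_lattice F" and S: "subframe F S"
begin

interpretation complete_lattice F by (fact F)

lemma partial_order_subframe: "partial_order (F\<lparr>carrier := S\<rparr>)"
proof -
  have "S \<subseteq> carrier F" using S by (simp add: subframe_def)
  then show ?thesis
    by unfold_locales (auto simp: eq_is_equal subset_iff intro: le_antisym le_trans)
qed

text \<open>Joins for the restricted carrier are chosen among least upper bounds inside
  \<open>S\<close>, so they must be identified with those of \<open>F\<close>. The join in
  \<open>F\<close> already lies in \<open>S\<close>, hence is least there too, and least elements
  are unique.\<close>

lemma Sup_subframe:
  assumes "T \<subseteq> S"
  shows "\<Squnion>\<^bsub>F\<lparr>carrier := S\<rparr>\<^esub> T = \<Squnion>\<^bsub>F\<^esub> T"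
proof -
  interpret S: partial_order "F\<lparr>carrier := S\<rparr>" by (rule partial_order_subframe)
  have SF: "S \<subseteq> carrier F" "T \<subseteq> carrier F" using S assms by (auto simp: subframe_def)
  have l: "least (F\<lparr>carrier := S\<rparr>) (\<Squnion>\<^bsub>F\<^esub> T) (Upper (F\<lparr>carrier := S\<rparr>) T)"
    using S assms SF by (auto simp: least_def Upper_def subframe_def intro!: sup_upper sup_least)
  show ?thesis
    unfolding Lattice.sup_def[of "F\<lparr>carrier := S\<rparr>"]
    by (rule some_equality, rule l) (rule S.least_unique[OF _ l])
qed

lemma meet_subframe:
  assumes "x \<in> S" "y \<in> S"
  shows "x \<sqinter>\<^bsub>F\<lparr>carrier := S\<rparr>\<^esub> y = x \<sqinter>\<^bsub>F\<^esub> y"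
proof -
  interpret S: partial_order "F\<lparr>carrier := S\<rparr>" by (rule partial_order_subframe)
  have SF: "S \<subseteq> carrier F" "x \<in> carrier F" "y \<in> carrier F" using S assms by (auto simp: subframe_def)
  have g: "greatest (F\<lparr>carrier := S\<rparr>) (x \<sqinter>\<^bsub>F\<^esub> y) (Lower (F\<lparr>carrier := S\<rparr>) {x, y})"
    using S assms SF meet_left[OF SF(2,3)] meet_right[OF SF(2,3)] meet_le[OF _ _ SF(2,3)]
    by (auto simp: greatest_def Lower_def subframe_def)
  show ?thesis
    unfolding meet_def[of "F\<lparr>carrier := S\<rparr>"] Lattice.inf_def[of "F\<lparr>carrier := S\<rparr>"]
    by (rule some_equality, rule g) (rule S.greatest_unique[OF _ g])
qed

lemma top_subframe: "\<top>\<^bsub>F\<lparr>carrier := S\<rparr>\<^esub> = \<top>\<^bsub>F\<^esub>"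
proof -
  interpret S: partial_order "F\<lparr>carrier := S\<rparr>" by (rule partial_order_subframe)
  have "greatest (F\<lparr>carrier := S\<rparr>) \<top>\<^bsub>F\<^esub> S"
    using S top_higher by (auto simp: greatest_def subframe_def)
  then show ?thesis
    unfolding Order.top_def[of "F\<lparr>carrier := S\<rparr>"]
    using S.greatest_unique by (intro some_equality) auto
qed

lemma frame_map_subframe_two:
  "frame_map (F\<lparr>carrier := S\<rparr>) two g \<longleftrightarrow>
     (\<forall>T \<subseteq> S. g (\<Squnion>\<^bsub>F\<^esub> T) \<longleftrightarrow> (\<exists>x\<in>T. g x)) \<and> g \<top>\<^bsub>F\<^esub> \<and>
     (\<forall>x \<in> S. \<forall>y \<in> S. g (x \<sqinter>\<^bsub>F\<^esub> y) \<longleftrightarrow> g x \<and> g y)"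
  by (simp add: frame_map_two Sup_subframe meet_subframe top_subframe)

end

section \<open>Congruences\<close>

text \<open>Fixes the record type of \<open>frame\<close> to plain \<open>gorder\<close>, the type
  on which \<open>congruence\<close>, \<open>nabla\<close> and \<open>delta\<close> are
  defined.\<close>

locale gorder_frame = frame L for L :: "'a gorder" (structure)
begin

lemma congruenceI:
  assumes "equiv (carrier L) \<theta>"
    and "\<And>R. R \<subseteq> \<theta> \<Longrightarrow> (\<Squnion>(fst ` R), \<Squnion>(snd ` R)) \<in> \<theta>"
    and "\<And>x y x' y'. \<lbrakk>(x, y) \<in> \<theta>; (x', y') \<in> \<theta>\<rbrakk> \<Longrightarrow> (x \<sqinter> x', y \<sqinter> y') \<in> \<theta>"
  shows "congruence L \<theta>"
  using assms by (simp add: congruence_def case_prod_unfold)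

lemma congruence_carrier: "congruence L \<theta> \<Longrightarrow> \<theta> \<subseteq> carrier L \<times> carrier L"
  by (auto simp: congruence_def equiv_def refl_on_def)

lemma congruence_refl: "congruence L \<theta> \<Longrightarrow> x \<in> carrier L \<Longrightarrow> (x, x) \<in> \<theta>"
  by (auto simp: congruence_def equiv_def refl_on_def)

lemma congruence_sym: "congruence L \<theta> \<Longrightarrow> (x, y) \<in> \<theta> \<Longrightarrow> (y, x) \<in> \<theta>"
  by (auto simp: congruence_def equiv_def sym_def)

lemma congruence_trans: "congruence L \<theta> \<Longrightarrow> (x, y) \<in> \<theta> \<Longrightarrow> (y, z) \<in> \<theta> \<Longrightarrow> (x, z) \<in> \<theta>"
  unfolding congruence_def equiv_def by (meson transD)

lemma congruence_Sup:
  "congruence L \<theta> \<Longrightarrow> R \<subseteq> \<theta> \<Longrightarrow> (\<Squnion>(fst ` R), \<Squnion>(snd ` R)) \<in> \<theta>"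
  by (auto simp: congruence_def)

lemma congruence_join:
  "congruence L \<theta> \<Longrightarrow> (x, y) \<in> \<theta> \<Longrightarrow> (x', y') \<in> \<theta> \<Longrightarrow> (x \<squnion> x', y \<squnion> y') \<in> \<theta>"
  using congruence_Sup[of \<theta> "{(x, y), (x', y')}"] by (simp add: join_def)

lemma congruence_meet:
  "congruence L \<theta> \<Longrightarrow> (x, y) \<in> \<theta> \<Longrightarrow> (x', y') \<in> \<theta> \<Longrightarrow> (x \<sqinter> x', y \<sqinter> y') \<in> \<theta>"
  by (auto simp: congruence_def)

lemma congruence_Inter:
  assumes "\<And>\<theta>. \<theta> \<in> \<Theta> \<Longrightarrow> congruence L \<theta>" "\<Theta> \<noteq> {}"
  shows "congruence L (\<Inter>\<Theta>)"
proof -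
  have "equiv (carrier L) (\<Inter>\<Theta>)"
  proof (rule equivI)
    show "\<Inter>\<Theta> \<subseteq> carrier L \<times> carrier L"
      using assms congruence_carrier by (meson Inter_lower all_not_in_conv order_trans)
    show "refl_on (carrier L) (\<Inter>\<Theta>)"
      using assms(1) congruence_refl by (simp add: refl_on_def)
    show "sym (\<Inter>\<Theta>)"
      using assms(1) congruence_sym by (simp add: sym_def)
    show "trans (\<Inter>\<Theta>)"
    proof (rule transI, rule InterI)
      fix x y z \<theta> assume "(x, y) \<in> \<Inter>\<Theta>" "(y, z) \<in> \<Inter>\<Theta>" "\<theta> \<in> \<Theta>"
      then show "(x, z) \<in> \<theta>" using assms(1) congruence_trans[of \<theta> x y z] by simp
    qed
  qed
  moreover have "(\<Squnion>(fst ` R), \<Squnion>(snd ` R)) \<in> \<Inter>\<Theta>" if R: "R \<subseteq> \<Inter>\<Theta>" for R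
  proof
    fix \<theta> assume "\<theta> \<in> \<Theta>"
    with R have "R \<subseteq> \<theta>" by (simp add: le_Inf_iff)
    then show "(\<Squnion>(fst ` R), \<Squnion>(snd ` R)) \<in> \<theta>"
      using assms(1)[OF \<open>\<theta> \<in> \<Theta>\<close>] by (intro congruence_Sup)
  qed
  moreover have "(x \<sqinter> x', y \<sqinter> y') \<in> \<Inter>\<Theta>" if "(x, y) \<in> \<Inter>\<Theta>" "(x', y') \<in> \<Inter>\<Theta>" for x y x' y'
    using that assms(1) congruence_meet by simp
  ultimately show ?thesis
    by (simp add: congruence_def case_prod_unfold)
qed

lemma congruence_total: "congruence L (carrier L \<times> carrier L)"
proof -
  have "equiv (carrier L) (carrier L \<times> carrier L)"
    by (auto intro!: equivI refl_onI symI transI)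
  moreover have "fst ` R \<subseteq> carrier L" "snd ` R \<subseteq> carrier L" if "R \<subseteq> carrier L \<times> carrier L" for R
    using that by auto
  ultimately show ?thesis unfolding congruence_def by auto
qed

text \<open>Meeting the pair of bottom and top with any \<open>x\<close> relates bottom to
  \<open>x\<close>, so everything collapses into one class.\<close>

lemma congruence_eq_total:
  assumes "congruence L \<theta>" "(\<bottom>, \<top>) \<in> \<theta>"
  shows "\<theta> = carrier L \<times> carrier L"
proof -
  have "(\<bottom>, x) \<in> \<theta>" if "x \<in> carrier L" for x
    using congruence_meet[OF assms(1) assms(2) congruence_refl[OF assms(1) that]] that
    by (simp add: bottom_meet[unfolded eq_is_equal] top_meet[unfolded eq_is_equal])
  then have "(x, y) \<in> \<theta>" if "x \<in> carrier L" "y \<in> carrier L" for x y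
    using that congruence_sym[OF assms(1)] congruence_trans[OF assms(1), of x \<bottom> y] by simp
  then show ?thesis
    using congruence_carrier[OF assms(1)] by auto
qed

lemma carrier_congruence_frame [simp]: "carrier (congruence_frame L) = {\<theta>. congruence L \<theta>}"
  by (simp add: congruence_frame_def)

lemma le_congruence_frame [simp]: "\<theta> \<sqsubseteq>\<^bsub>congruence_frame L\<^esub> \<phi> \<longleftrightarrow> \<theta> \<subseteq> \<phi>"
  by (simp add: congruence_frame_def)

text \<open>A greatest congruence and nonempty intersections suffice; joins then exist as
  intersections of upper bounds.\<close>

lemma complete_lattice_congruence_frame: "complete_lattice (congruence_frame L)"
proof -
  interpret C: partial_order "congruence_frame L"
    by unfold_locales (auto simp: congruence_frame_def)
  show ?thesis
  proof (rule C.complete_lattice_criterion1)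
    show "\<exists>g. greatest (congruence_frame L) g (carrier (congruence_frame L))"
      using congruence_total congruence_carrier
      by (intro exI[of _ "carrier L \<times> carrier L"]) (auto simp: greatest_def)
  next
    fix A assume A: "A \<subseteq> carrier (congruence_frame L)" "A \<noteq> {}"
    then have "congruence L (\<Inter>A)" by (intro congruence_Inter) auto
    with A show "\<exists>i. greatest (congruence_frame L) i (Lower (congruence_frame L) A)"
      by (intro exI[of _ "\<Inter>A"]) (auto simp: greatest_def Lower_def)
  qed
qed

interpretation C: complete_lattice "congruence_frame L"
  by (rule complete_lattice_congruence_frame)

lemma top_congruence_frame [simp]: "\<top>\<^bsub>congruence_frame L\<^esub> = carrier L \<times> carrier L"
proof
  show "\<top>\<^bsub>congruence_frame L\<^esub> \<subseteq> carrier L \<times> carrier L"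
    using C.top_closed congruence_carrier by simp
  show "carrier L \<times> carrier L \<subseteq> \<top>\<^bsub>congruence_frame L\<^esub>"
    using C.top_higher[of "carrier L \<times> carrier L"] congruence_total by simp
qed

lemma meet_congruence_frame [simp]:
  assumes "congruence L \<theta>" "congruence L \<phi>"
  shows "\<theta> \<sqinter>\<^bsub>congruence_frame L\<^esub> \<phi> = \<theta> \<inter> \<phi>"
proof -
  have "congruence L (\<theta> \<inter> \<phi>)" using congruence_Inter[of "{\<theta>, \<phi>}"] assms by auto
  then show ?thesis
    using assms C.meet_left[of \<theta> \<phi>] C.meet_right[of \<theta> \<phi>] C.meet_le[of "\<theta> \<inter> \<phi>" \<theta> \<phi>]
    by auto
qed

lemma subset_Sup_congruence_frame:
  assumes "\<And>\<theta>. \<theta> \<in> \<Theta> \<Longrightarrow> congruence L \<theta>" "\<phi> \<in> \<Theta>"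
  shows "\<phi> \<subseteq> \<Squnion>\<^bsub>congruence_frame L\<^esub> \<Theta>"
proof -
  have "\<Theta> \<subseteq> carrier (congruence_frame L)" using assms(1) by auto
  from C.sup_upper[OF this assms(2)] show ?thesis by simp
qed

text \<open>The universal property of joins of congruences, which stands in for a description of
  their elements.\<close>

lemma Sup_congruence_frame_subset_iff:
  assumes "\<And>\<theta>. \<theta> \<in> \<Theta> \<Longrightarrow> congruence L \<theta>" "congruence L \<phi>"
  shows "\<Squnion>\<^bsub>congruence_frame L\<^esub> \<Theta> \<subseteq> \<phi> \<longleftrightarrow> (\<forall>\<theta>\<in>\<Theta>. \<theta> \<subseteq> \<phi>)"
proof -
  have \<Theta>: "\<Theta> \<subseteq> carrier (congruence_frame L)" using assms(1) by auto
  show ?thesis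
    using C.sup_upper[OF \<Theta>, simplified] C.sup_least[OF \<Theta>, of \<phi>, simplified] assms(2)
    by (meson order_trans)
qed

lemma congruence_Sup_congruence_frame:
  assumes "\<And>\<theta>. \<theta> \<in> \<Theta> \<Longrightarrow> congruence L \<theta>"
  shows "congruence L (\<Squnion>\<^bsub>congruence_frame L\<^esub> \<Theta>)"
  using assms C.sup_closed[of \<Theta>] by auto

subsection \<open>Open and closed congruences\<close>

lemma nabla_iff: "(x, y) \<in> nabla L a \<longleftrightarrow> x \<in> carrier L \<and> y \<in> carrier L \<and> x \<squnion> a = y \<squnion> a"
  by (simp add: nabla_def)

lemma delta_iff: "(x, y) \<in> delta L a \<longleftrightarrow> x \<in> carrier L \<and> y \<in> carrier L \<and> x \<sqinter> a = y \<sqinter> a"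
  by (simp add: delta_def)

lemma congruence_nabla:
  assumes a: "a \<in> carrier L"
  shows "congruence L (nabla L a)"
proof -
  have "equiv (carrier L) (nabla L a)"
    by (rule equivI) (auto simp: nabla_def refl_on_def sym_def trans_def)
  moreover have "(\<Squnion>(fst ` R), \<Squnion>(snd ` R)) \<in> nabla L a" if R: "R \<subseteq> nabla L a" for R
  proof -
    have sub: "fst ` R \<subseteq> carrier L" "snd ` R \<subseteq> carrier L"
      using R by (auto simp: nabla_def)
    \<comment> \<open>One inequality, applied to \<open>R\<close> in both directions. Distributing
      \<open>a\<close> over the family would fail for the empty join, so each member is bounded
      separately and \<open>a\<close> is bounded on its own.\<close>
    have le: "\<Squnion>A \<squnion> a \<sqsubseteq> \<Squnion>B \<squnion> a"
      if "A \<subseteq> carrier L" "B \<subseteq> carrier L" "\<And>x. x \<in> A \<Longrightarrow> \<exists>y\<in>B. x \<squnion> a = y \<squnion> a" for A B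
    proof -
      have "x \<sqsubseteq> \<Squnion>B \<squnion> a" if "x \<in> A" for x
      proof -
        obtain y where y: "y \<in> B" "x \<squnion> a = y \<squnion> a"
          using \<open>x \<in> A\<close> \<open>\<And>x. x \<in> A \<Longrightarrow> \<exists>y\<in>B. x \<squnion> a = y \<squnion> a\<close> by blast
        have c: "x \<in> carrier L" "y \<in> carrier L" "\<Squnion>B \<in> carrier L"
          using y(1) that \<open>A \<subseteq> carrier L\<close> \<open>B \<subseteq> carrier L\<close> by auto
        have "y \<squnion> a \<sqsubseteq> \<Squnion>B \<squnion> a"
          using c a sup_upper[OF \<open>B \<subseteq> carrier L\<close> y(1)]
          by (simp add: join_le_iff le_join1 join_right)
        moreover have "x \<sqsubseteq> x \<squnion> a" using c a by (simp add: join_left)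
        ultimately show ?thesis
          using c a y(2) by (auto intro: le_trans[of x "y \<squnion> a"])
      qed
      then show ?thesis
        using that(1,2) a by (simp add: join_le_iff Sup_le_iff join_right)
    qed
    have R': "x \<squnion> a = y \<squnion> a" if "(x, y) \<in> R" for x y
      using subsetD[OF R that] by (simp add: nabla_iff)
    have "\<exists>y\<in>snd ` R. x \<squnion> a = y \<squnion> a" if "x \<in> fst ` R" for x
    proof -
      from that obtain y where y: "(x, y) \<in> R" by auto
      then show ?thesis using R'[OF y] by (intro bexI[of _ y]) (simp, rule image_eqI[of _ _ "(x, y)"], simp_all)
    qed
    moreover have "\<exists>x\<in>fst ` R. y \<squnion> a = x \<squnion> a" if "y \<in> snd ` R" for y
    proof -
      from that obtain x where x: "(x, y) \<in> R" by auto
      then show ?thesis using R'[OF x] by (intro bexI[of _ x]) (simp, rule image_eqI[of _ _ "(x, y)"], simp_all)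
    qed
    ultimately have "\<Squnion>(fst ` R) \<squnion> a = \<Squnion>(snd ` R) \<squnion> a"
      using sub a by (intro le_antisym le) auto
    then show ?thesis using sub by (simp add: nabla_iff)
  qed
  moreover have "(x \<sqinter> x', y \<sqinter> y') \<in> nabla L a" if "(x, y) \<in> nabla L a" "(x', y') \<in> nabla L a" for x y x' y'
    using that a by (simp add: nabla_iff join_comm[of L _ a] join_meet_distrib)
  ultimately show ?thesis by (rule congruenceI)
qed

lemma congruence_delta:
  assumes a: "a \<in> carrier L"
  shows "congruence L (delta L a)"
proof -
  have "equiv (carrier L) (delta L a)"
    by (rule equivI) (auto simp: delta_def refl_on_def sym_def trans_def)
  moreover have "(\<Squnion>(fst ` R), \<Squnion>(snd ` R)) \<in> delta L a" if R: "R \<subseteq> delta L a" for R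
  proof -
    have sub: "fst ` R \<subseteq> carrier L" "snd ` R \<subseteq> carrier L"
      using R by (auto simp: delta_def)
    \<comment> \<open>The two families have the same meets with \<open>a\<close>, so the frame law
      gives equal meets of their joins with \<open>a\<close>.\<close>
    have "(\<lambda>s. a \<sqinter> s) ` fst ` R = (\<lambda>s. a \<sqinter> s) ` snd ` R"
      unfolding image_image
      by (rule image_cong) (use R in \<open>auto simp: delta_def meet_comm[of L a]\<close>)
    then have "a \<sqinter> \<Squnion>(fst ` R) = a \<sqinter> \<Squnion>(snd ` R)"
      using sub a by (simp add: meet_sup_distrib)
    then show ?thesis using sub by (simp add: delta_iff meet_comm[of L _ a])
  qed
  moreover have "(x \<sqinter> x', y \<sqinter> y') \<in> delta L a" if "(x, y) \<in> delta L a" "(x', y') \<in> delta L a" for x y x' y'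
  proof -
    have c: "x \<in> carrier L" "x' \<in> carrier L" "y \<in> carrier L" "y' \<in> carrier L"
      and e: "x \<sqinter> a = y \<sqinter> a" "x' \<sqinter> a = y' \<sqinter> a"
      using that by (simp_all add: delta_iff)
    then have "x \<sqinter> x' \<sqinter> a = y \<sqinter> y' \<sqinter> a"
      by (simp only: meet_meet_distrib a)
    with c show ?thesis by (simp add: delta_iff)
  qed
  ultimately show ?thesis by (rule congruenceI)
qed

text \<open>\<open>nabla L a\<close> is the congruence generated by the pair of bottom and
  \<open>a\<close>: joining that pair with \<open>x\<close> relates \<open>x\<close> to
  \<open>x \<squnion> a\<close>, and elements with the same join with \<open>a\<close> are then
  linked through it. Inclusions of \<open>nabla\<close> thus reduce to one pair.\<close>

lemma nabla_subset_iff: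
  assumes a: "a \<in> carrier L" and \<theta>: "congruence L \<theta>"
  shows "nabla L a \<subseteq> \<theta> \<longleftrightarrow> (\<bottom>, a) \<in> \<theta>"
proof
  have "a \<squnion> a = a" using a le_iff_meet[of a a] by simp
  then have "(\<bottom>, a) \<in> nabla L a" using a by (simp add: nabla_iff bottom_join_eq)
  then show "(\<bottom>, a) \<in> \<theta>" if "nabla L a \<subseteq> \<theta>" using that by (rule rev_subsetD)
next
  assume 0: "(\<bottom>, a) \<in> \<theta>"
  have *: "(x, x \<squnion> a) \<in> \<theta>" if "x \<in> carrier L" for x
    using congruence_join[OF \<theta> 0 congruence_refl[OF \<theta> that]] that
    by (simp add: bottom_join_eq join_comm[of L a])
  show "nabla L a \<subseteq> \<theta>"
  proof (rule subrelI)
    fix x y assume xy: "(x, y) \<in> nabla L a"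
    then have "(x, y \<squnion> a) \<in> \<theta>" using *[of x] by (simp add: nabla_iff)
    moreover have "(y \<squnion> a, y) \<in> \<theta>"
      using *[of y] xy congruence_sym[OF \<theta>] by (simp add: nabla_iff)
    ultimately show "(x, y) \<in> \<theta>" by (rule congruence_trans[OF \<theta>])
  qed
qed

text \<open>Together with \<open>nabla_meet\<close> and \<open>nabla_top\<close>, this makes
  \<open>nabla\<close> preserve the frame operations, so that a point of the assembly restricts to a
  point of \<open>L\<close>.\<close>

lemma nabla_Sup:
  assumes A: "A \<subseteq> carrier L"
  shows "nabla L (\<Squnion>A) = \<Squnion>\<^bsub>congruence_frame L\<^esub> (nabla L ` A)"
proof
  let ?\<theta> = "\<Squnion>\<^bsub>congruence_frame L\<^esub> (nabla L ` A)"
  have c: "congruence L \<phi>" if "\<phi> \<in> nabla L ` A" for \<phi>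
    using that A congruence_nabla by auto
  have \<theta>: "congruence L ?\<theta>" by (rule congruence_Sup_congruence_frame[OF c])
  have "(\<bottom>, x) \<in> ?\<theta>" if "x \<in> A" for x
  proof -
    have "nabla L x \<subseteq> ?\<theta>"
      by (rule subset_Sup_congruence_frame[OF c]) (use that in simp_all)
    then show ?thesis using nabla_subset_iff[OF _ \<theta>] that A by auto
  qed
  \<comment> \<open>All pairs of bottom with an element of \<open>A\<close> are joined at once; the
    first coordinates join to bottom whether or not \<open>A\<close> is empty.\<close>
  then have "(\<Squnion>(fst ` Pair \<bottom> ` A), \<Squnion>(snd ` Pair \<bottom> ` A)) \<in> ?\<theta>"
    by (intro congruence_Sup[OF \<theta>]) auto
  moreover have "\<Squnion>(fst ` Pair \<bottom> ` A) = \<bottom>"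
    by (rule le_antisym) (auto intro!: sup_least bottom_lower sup_closed)
  moreover have "snd ` Pair \<bottom> ` A = A" by (simp add: image_image)
  ultimately show "nabla L (\<Squnion>A) \<subseteq> ?\<theta>"
    using nabla_subset_iff[OF _ \<theta>] A by simp
  have "nabla L x \<subseteq> nabla L (\<Squnion>A)" if "x \<in> A" for x
  proof -
    have x: "x \<in> carrier L" "\<Squnion>A \<in> carrier L" using that A by auto
    then have "x \<squnion> \<Squnion>A = \<Squnion>A" using le_iff_meet sup_upper[OF A that] by simp
    then show ?thesis
      using x by (simp add: nabla_subset_iff congruence_nabla nabla_iff bottom_join_eq)
  qed
  then show "?\<theta> \<subseteq> nabla L (\<Squnion>A)"
    using A by (subst Sup_congruence_frame_subset_iff[OF c]) (auto intro: congruence_nabla)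
qed

lemma nabla_meet:
  assumes "a \<in> carrier L" "b \<in> carrier L"
  shows "nabla L (a \<sqinter> b) = nabla L a \<sqinter>\<^bsub>congruence_frame L\<^esub> nabla L b"
proof -
  have "a \<sqinter> b \<squnion> a = a" "a \<sqinter> b \<squnion> b = b"
    using assms meet_left[of a b] meet_right[of a b]
      le_iff_meet[of "a \<sqinter> b" a] le_iff_meet[of "a \<sqinter> b" b] by simp_all
  then have "nabla L (a \<sqinter> b) \<subseteq> nabla L a" "nabla L (a \<sqinter> b) \<subseteq> nabla L b"
    using assms by (simp_all add: nabla_subset_iff congruence_nabla nabla_iff bottom_join_eq)
  moreover have "nabla L a \<inter> nabla L b \<subseteq> nabla L (a \<sqinter> b)"
    using assms by (auto simp: nabla_def join_meet_distrib)
  ultimately show ?thesis using assms by (simp add: congruence_nabla) blast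
qed

lemma nabla_top: "nabla L \<top> = carrier L \<times> carrier L"
  by (rule congruence_eq_total) (use nabla_subset_iff[of \<top> "nabla L \<top>"] congruence_nabla in auto)

text \<open>Cancellation leaves only diagonal pairs in the meet. The least congruence is written as
  an empty join because that is the form in which \<open>frame_map_two\<close> sends it to
  \<open>False\<close>.\<close>

lemma nabla_meet_delta:
  assumes a: "a \<in> carrier L"
  shows "nabla L a \<sqinter>\<^bsub>congruence_frame L\<^esub> delta L a = \<Squnion>\<^bsub>congruence_frame L\<^esub> {}"
proof
  have 0: "congruence L (\<Squnion>\<^bsub>congruence_frame L\<^esub> {})"
    by (rule congruence_Sup_congruence_frame) simp
  have "(x, y) \<in> \<Squnion>\<^bsub>congruence_frame L\<^esub> {}" if "(x, y) \<in> nabla L a \<inter> delta L a" for x y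
  proof -
    have "x = y" by (rule join_meet_cancel[of x y a]) (use that a in \<open>simp_all add: nabla_iff delta_iff\<close>)
    then show ?thesis using that congruence_refl[OF 0] by (simp add: nabla_iff)
  qed
  then have "nabla L a \<inter> delta L a \<subseteq> \<Squnion>\<^bsub>congruence_frame L\<^esub> {}"
    by (rule subrelI)
  then show "nabla L a \<sqinter>\<^bsub>congruence_frame L\<^esub> delta L a \<subseteq> \<Squnion>\<^bsub>congruence_frame L\<^esub> {}"
    using a by (simp add: congruence_nabla congruence_delta)
  have "congruence L (nabla L a \<sqinter>\<^bsub>congruence_frame L\<^esub> delta L a)"
    using a C.meet_closed[of "nabla L a" "delta L a"] by (simp add: congruence_nabla congruence_delta)
  then show "\<Squnion>\<^bsub>congruence_frame L\<^esub> {} \<subseteq> nabla L a \<sqinter>\<^bsub>congruence_frame L\<^esub> delta L a"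
    by (subst Sup_congruence_frame_subset_iff) auto
qed

lemma top_delta: "a \<in> carrier L \<Longrightarrow> (a, \<top>) \<in> delta L a"
  using le_iff_join[of a a] by (simp add: delta_iff top_meet_eq)

text \<open>In the join, bottom is related to \<open>a\<close> by \<open>nabla\<close> and
  \<open>a\<close> to top by \<open>delta\<close>, so transitivity collapses everything.\<close>

lemma nabla_join_delta:
  assumes a: "a \<in> carrier L"
  shows "\<Squnion>\<^bsub>congruence_frame L\<^esub> {nabla L a, delta L a} = \<top>\<^bsub>congruence_frame L\<^esub>"
proof -
  let ?\<theta> = "\<Squnion>\<^bsub>congruence_frame L\<^esub> {nabla L a, delta L a}"
  have c: "congruence L \<phi>" if "\<phi> \<in> {nabla L a, delta L a}" for \<phi>
    using that a congruence_nabla congruence_delta by auto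
  have \<theta>: "congruence L ?\<theta>" by (rule congruence_Sup_congruence_frame[OF c])
  have "nabla L a \<subseteq> ?\<theta>" "delta L a \<subseteq> ?\<theta>"
    by (rule subset_Sup_congruence_frame[OF c]; simp)+
  then have "(\<bottom>, a) \<in> ?\<theta>" "(a, \<top>) \<in> ?\<theta>"
    using nabla_subset_iff[OF a \<theta>] top_delta[OF a] by auto
  then have "(\<bottom>, \<top>) \<in> ?\<theta>" by (rule congruence_trans[OF \<theta>])
  then show ?thesis using congruence_eq_total[OF \<theta>] by simp
qed

end

section \<open>Extending points to congruences\<close>

text \<open>Non-inclusion in the kernel of \<open>f\<close>, phrased through a witnessing pair so
  that no carrier is mentioned; \<open>separates_iff\<close> returns to the kernel.\<close>

definition separates :: "('a \<Rightarrow> bool) \<Rightarrow> ('a \<times> 'a) set \<Rightarrow> bool" where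
  "separates f \<theta> \<longleftrightarrow> (\<exists>(x, y) \<in> \<theta>. f x \<noteq> f y)"

context gorder_frame
begin

context
  fixes f assumes f: "frame_map L two f"
begin

lemma congruence_kernel: "congruence L {(x, y) \<in> carrier L \<times> carrier L. f x = f y}" (is "congruence L ?K")
proof -
  have "equiv (carrier L) ?K"
    by (rule equivI) (auto simp: refl_on_def sym_def trans_def)
  moreover have "(\<Squnion>(fst ` R), \<Squnion>(snd ` R)) \<in> ?K" if R: "R \<subseteq> ?K" for R
  proof -
    have sub: "fst ` R \<subseteq> carrier L" "snd ` R \<subseteq> carrier L" using R by auto
    have "f ` fst ` R = f ` snd ` R"
      unfolding image_image by (rule image_cong) (use R in auto)
    then have "f (\<Squnion>(fst ` R)) = f (\<Squnion>(snd ` R))" using f sub by (simp add: frame_map_def)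
    then show ?thesis using sub by simp
  qed
  moreover have "(x \<sqinter> x', y \<sqinter> y') \<in> ?K" if "(x, y) \<in> ?K" "(x', y') \<in> ?K" for x y x' y'
    using that f by (simp add: frame_map_two)
  ultimately show ?thesis by (rule congruenceI)
qed

lemma separates_iff:
  "congruence L \<theta> \<Longrightarrow> separates f \<theta> \<longleftrightarrow> \<not> \<theta> \<subseteq> {(x, y) \<in> carrier L \<times> carrier L. f x = f y}"
  using congruence_carrier[of \<theta>] by (auto simp: separates_def)

lemma separates_Sup:
  assumes "\<And>\<theta>. \<theta> \<in> \<Theta> \<Longrightarrow> congruence L \<theta>"
  shows "separates f (\<Squnion>\<^bsub>congruence_frame L\<^esub> \<Theta>) \<longleftrightarrow> (\<exists>\<theta>\<in>\<Theta>. separates f \<theta>)"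
  using Sup_congruence_frame_subset_iff[OF assms congruence_kernel]
  by (simp add: separates_iff assms congruence_Sup_congruence_frame)

lemma separates_total: "separates f (carrier L \<times> carrier L)"
proof -
  have "\<not> f (\<Squnion>{})" "f \<top>" using f by (simp_all add: frame_map_two)
  then show ?thesis unfolding separates_def by (intro bexI[of _ "(\<top>, \<Squnion>{})"]) auto
qed

text \<open>Symmetry orients the witnessing pair, and meeting it with its larger-valued member makes
  it comparable. Comparability is what lets two witnesses be combined in
  \<open>separates_Int\<close>.\<close>

lemma separatesE:
  assumes "congruence L \<theta>" "separates f \<theta>"
  obtains x y where "(x, y) \<in> \<theta>" "x \<in> carrier L" "y \<in> carrier L" "y \<sqsubseteq> x" "f x" "\<not> f y"
proof -
  obtain x y where "(x, y) \<in> \<theta>" "f x \<noteq> f y" using assms(2) by (auto simp: separates_def)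
  then obtain u v where uv: "(u, v) \<in> \<theta>" "f u" "\<not> f v"
    using congruence_sym[OF assms(1), of x y] by (cases "f x") auto
  have c: "u \<in> carrier L" "v \<in> carrier L" using uv congruence_carrier[OF assms(1)] by auto
  have "u \<sqinter> u = u" using c le_iff_join[of u u] by simp
  then have "(u, u \<sqinter> v) \<in> \<theta>"
    using congruence_meet[OF assms(1) congruence_refl[OF assms(1) c(1)] uv(1)] by simp
  moreover have "\<not> f (u \<sqinter> v)" using f c uv by (simp add: frame_map_two)
  ultimately show ?thesis using c uv by (intro that[of u "u \<sqinter> v"]) (auto simp: meet_left)
qed

text \<open>Primeness of the kernel: from a witness of each congruence, a single pair lying in both
  must be produced that \<open>f\<close> still separates.\<close>

lemma separates_Int:
  assumes \<theta>: "congruence L \<theta>" and \<phi>: "congruence L \<phi>"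
  shows "separates f (\<theta> \<inter> \<phi>) \<longleftrightarrow> separates f \<theta> \<and> separates f \<phi>"
proof
  assume "separates f \<theta> \<and> separates f \<phi>"
  then obtain x y u v where
    xy: "(x, y) \<in> \<theta>" "x \<in> carrier L" "y \<in> carrier L" "y \<sqsubseteq> x" "f x" "\<not> f y" and
    uv: "(u, v) \<in> \<phi>" "u \<in> carrier L" "v \<in> carrier L" "v \<sqsubseteq> u" "f u" "\<not> f v"
    using separatesE[OF \<theta>] separatesE[OF \<phi>] by metis
  \<comment> \<open>\<open>?p\<close> is related to \<open>?q\<close> by \<theta> and to
    \<open>?r\<close> by \<phi>, and lies above both. Joining the first pair with \<open>?r\<close>
    and the second with \<open>?q\<close> relates \<open>?p\<close> to
    \<open>?q \<squnion> ?r\<close> in both congruences, while \<open>f\<close> is true at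
    \<open>?p\<close> and false at \<open>?q\<close> and \<open>?r\<close>.\<close>
  let ?p = "x \<sqinter> u" and ?q = "y \<sqinter> u" and ?r = "x \<sqinter> v"
  have c: "?p \<in> carrier L" "?q \<in> carrier L" "?r \<in> carrier L" using xy uv by auto
  have "?q \<sqsubseteq> x" "?r \<sqsubseteq> u"
    using xy uv le_trans[OF meet_left[of y u] xy(4)] le_trans[OF meet_right[of x v] uv(4)] by auto
  then have "?q \<sqsubseteq> ?p" "?r \<sqsubseteq> ?p"
    using xy uv by (simp_all add: le_meet_iff meet_left meet_right)
  then have p: "?p \<squnion> ?r = ?p" "?p \<squnion> ?q = ?p"
    using c le_iff_meet[of ?r ?p] le_iff_meet[of ?q ?p]
    by (simp_all add: join_comm[of L ?p ?r] join_comm[of L ?p ?q])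
  have "(?p, ?q) \<in> \<theta>" using congruence_meet[OF \<theta> xy(1) congruence_refl[OF \<theta> uv(2)]] .
  from congruence_join[OF \<theta> this congruence_refl[OF \<theta> c(3)]]
  have "(?p, ?q \<squnion> ?r) \<in> \<theta>" by (simp only: p)
  moreover have "(?p, ?r) \<in> \<phi>" using congruence_meet[OF \<phi> congruence_refl[OF \<phi> xy(2)] uv(1)] .
  from congruence_join[OF \<phi> this congruence_refl[OF \<phi> c(2)]]
  have "(?p, ?q \<squnion> ?r) \<in> \<phi>" by (simp only: p join_comm[of L ?q ?r])
  moreover have "f ?p" "\<not> f (?q \<squnion> ?r)"
    using f c xy uv by (simp_all add: frame_map_two_join) (simp_all add: frame_map_two)
  ultimately show "separates f (\<theta> \<inter> \<phi>)" by (auto simp: separates_def)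
qed (auto simp: separates_def)

text \<open>As \<open>nabla L a\<close> is generated by the pair of bottom and \<open>a\<close>, and
  \<open>f\<close> is false at bottom, only the value at \<open>a\<close> decides. Hence the
  extension restricts to \<open>f\<close> along \<open>nabla\<close>.\<close>

lemma separates_nabla:
  assumes a: "a \<in> carrier L"
  shows "separates f (nabla L a) \<longleftrightarrow> f a"
proof -
  have "\<Squnion>{} = \<bottom>" using weak_sup_empty by (simp add: eq_is_equal)
  moreover have "\<not> f (\<Squnion>{})" using f by (simp add: frame_map_two)
  ultimately have "\<not> f \<bottom>" by simp
  then show ?thesis
    using a nabla_subset_iff[OF a congruence_kernel]
    by (simp add: separates_iff congruence_nabla)
qed

end

end

section \<open>Spectra of subframes\<close>

lemma frame_map_cong:
  assumes "frame L" "\<And>x. x \<in> carrier L \<Longrightarrow> f x = g x"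
  shows "frame_map L M f \<longleftrightarrow> frame_map L M g"
proof -
  interpret frame L by fact
  have *: "f ` S = g ` S" if "S \<subseteq> carrier L" for S
    using that assms(2) by (intro image_cong) auto
  show ?thesis
    unfolding frame_map_def using assms(2) * sup_closed by (simp add: Pi_iff cong: conj_cong)
qed

lemma frame_map_comp:
  assumes "frame_map L M f" "frame_map M N g"
  shows "frame_map L N (\<lambda>x. g (f x))"
proof -
  have f: "f x \<in> carrier M" if "x \<in> carrier L" for x
    using assms(1) that by (auto simp: frame_map_def)
  then have "f ` S \<subseteq> carrier M" if "S \<subseteq> carrier L" for S
    using that by auto
  then show ?thesis
    using assms f unfolding frame_map_def by (simp add: Pi_iff image_image[symmetric])
qed

text \<open>The elements of the hull on which two points agree form a subframe containing
  \<open>G\<close>.\<close>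

lemma points_eq_on_hull:
  assumes F: "complete_lattice F" and G: "G \<subseteq> carrier F"
    and g: "frame_map (generated_subframe F G) two g" and h: "frame_map (generated_subframe F G) two h"
    and eq: "\<And>x. x \<in> G \<Longrightarrow> g x = h x" and x: "x \<in> subframe F hull G"
  shows "g x = h x"
proof -
  let ?S = "subframe F hull G"
  note S = subframe_hull[OF F G]
  note pts = g[unfolded generated_subframe_def frame_map_subframe_two[OF F S]]
    h[unfolded generated_subframe_def frame_map_subframe_two[OF F S]]
  have "subframe F {x \<in> ?S. g x = h x}"
    unfolding subframe_def[of F "{x \<in> ?S. g x = h x}"]
  proof (intro conjI allI impI ballI)
    show "{x \<in> ?S. g x = h x} \<subseteq> carrier F" using S by (auto simp: subframe_def)
    show "\<Squnion>\<^bsub>F\<^esub> T \<in> {x \<in> ?S. g x = h x}" if "T \<subseteq> {x \<in> ?S. g x = h x}" for T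
    proof -
      have "T \<subseteq> ?S" "\<And>x. x \<in> T \<Longrightarrow> g x = h x" using that by auto
      then show ?thesis using pts S by (simp add: subframe_def)
    qed
    show "\<top>\<^bsub>F\<^esub> \<in> {x \<in> ?S. g x = h x}" using pts S by (simp add: subframe_def)
    show "x \<sqinter>\<^bsub>F\<^esub> y \<in> {x \<in> ?S. g x = h x}"
      if "x \<in> {x \<in> ?S. g x = h x}" "y \<in> {x \<in> ?S. g x = h x}" for x y
      using that pts S by (simp add: subframe_def)
  qed
  moreover have "G \<subseteq> {x \<in> ?S. g x = h x}" using eq hull_subset[of G "subframe F"] by auto
  ultimately have "?S \<subseteq> {x \<in> ?S. g x = h x}" by (rule hull_minimal[rotated])
  then show ?thesis using x by auto
qed

context
  fixes F :: "'a gorder" and S and Y :: "'g set" and \<pi> :: "'g \<Rightarrow> 'a \<Rightarrow> bool"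
  assumes F: "complete_lattice F" and S: "subframe F S"
    and hom: "\<And>g. g \<in> Y \<Longrightarrow> frame_map (F\<lparr>carrier := S\<rparr>) two (\<pi> g)"
begin

lemma spectrum_Sup:
  "\<lbrakk>g \<in> Y; T \<subseteq> S\<rbrakk> \<Longrightarrow> \<pi> g (\<Squnion>\<^bsub>F\<^esub> T) \<longleftrightarrow> (\<exists>x\<in>T. \<pi> g x)"
  and spectrum_top: "g \<in> Y \<Longrightarrow> \<pi> g \<top>\<^bsub>F\<^esub>"
  and spectrum_meet: "\<lbrakk>g \<in> Y; x \<in> S; y \<in> S\<rbrakk> \<Longrightarrow> \<pi> g (x \<sqinter>\<^bsub>F\<^esub> y) \<longleftrightarrow> \<pi> g x \<and> \<pi> g y"
  using hom by (simp_all add: frame_map_subframe_two[OF F S])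

text \<open>The analogue of \<open>istopology_spectrum\<close> for a subframe of a complete lattice:
  preservation of joins and meets by the points is all that the closure conditions use. It gives
  access to the opens of \<open>bpt (assembly L)\<close>.\<close>

lemma openin_spectrum:
  "openin (topology (\<lambda>U. \<exists>x\<in>S. U = {g \<in> Y. \<pi> g x})) U \<longleftrightarrow> (\<exists>x\<in>S. U = {g \<in> Y. \<pi> g x})"
proof -
  let ?P = "\<lambda>U. \<exists>x\<in>S. U = {g \<in> Y. \<pi> g x}"
  have "istopology ?P"
    unfolding istopology_def
  proof (intro conjI allI impI)
    fix U V assume "?P U" "?P V"
    then obtain x y where xy: "x \<in> S" "y \<in> S" "U = {g \<in> Y. \<pi> g x}" "V = {g \<in> Y. \<pi> g y}" by blast
    then have "U \<inter> V = {g \<in> Y. \<pi> g (x \<sqinter>\<^bsub>F\<^esub> y)}" by (auto simp: spectrum_meet)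
    moreover have "x \<sqinter>\<^bsub>F\<^esub> y \<in> S" using S xy by (simp add: subframe_def)
    ultimately show "?P (U \<inter> V)" by (rule bexI)
  next
    fix \<K> assume K: "\<forall>K\<in>\<K>. ?P K"
    \<comment> \<open>Every element naming a member of the family is taken, so no representatives
      have to be chosen.\<close>
    define T where "T = {x \<in> S. {g \<in> Y. \<pi> g x} \<in> \<K>}"
    have T: "T \<subseteq> S" by (auto simp: T_def)
    have "\<Union>\<K> = (\<Union>x\<in>T. {g \<in> Y. \<pi> g x})"
    proof (rule equalityI)
      show "\<Union>\<K> \<subseteq> (\<Union>x\<in>T. {g \<in> Y. \<pi> g x})"
      proof (rule Union_least)
        fix K assume "K \<in> \<K>"
        with K obtain x where "x \<in> S" "K = {g \<in> Y. \<pi> g x}" by blast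
        with \<open>K \<in> \<K>\<close> have "x \<in> T" "K = {g \<in> Y. \<pi> g x}" by (simp_all add: T_def)
        then show "K \<subseteq> (\<Union>x\<in>T. {g \<in> Y. \<pi> g x})" by blast
      qed
      show "(\<Union>x\<in>T. {g \<in> Y. \<pi> g x}) \<subseteq> \<Union>\<K>"
        by (intro UN_least Union_upper) (simp add: T_def)
    qed
    also have "\<dots> = {g \<in> Y. \<pi> g (\<Squnion>\<^bsub>F\<^esub> T)}"
      using T by (auto simp: spectrum_Sup)
    finally show "?P (\<Union>\<K>)" using T S by (intro bexI[of _ "\<Squnion>\<^bsub>F\<^esub> T"]) (simp_all add: subframe_def)
  qed
  then show ?thesis by (simp add: topology_inverse')
qed

lemma topspace_spectrum: "topspace (topology (\<lambda>U. \<exists>x\<in>S. U = {g \<in> Y. \<pi> g x})) = Y"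
proof
  show "topspace (topology (\<lambda>U. \<exists>x\<in>S. U = {g \<in> Y. \<pi> g x})) \<subseteq> Y"
    unfolding topspace_def by (auto simp: openin_spectrum)
  have "\<top>\<^bsub>F\<^esub> \<in> S" using S by (simp add: subframe_def)
  moreover have "Y = {g \<in> Y. \<pi> g \<top>\<^bsub>F\<^esub>}" using spectrum_top by auto
  ultimately show "Y \<subseteq> topspace (topology (\<lambda>U. \<exists>x\<in>S. U = {g \<in> Y. \<pi> g x}))"
    by (intro openin_subset) (simp only: openin_spectrum, rule bexI)
qed

end

text \<open>For continuity, the elements of the hull whose pulled-back point set is open form a
  subframe, so openness on \<open>G\<close> spreads to the whole hull. For the inverse, it is enough
  that each subbasic set in \<B> is the pullback of some element of the hull.\<close>

lemma homeomorphic_map_spectrum: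
  fixes F :: "'a gorder" and \<pi> :: "'g \<Rightarrow> 'a \<Rightarrow> bool"
  assumes F: "complete_lattice F" and G: "G \<subseteq> carrier F"
    and hom: "\<And>g. g \<in> Y \<Longrightarrow> frame_map (generated_subframe F G) two (\<pi> g)"
    and X: "X = \<Union>\<B>"
    and bij: "bij_betw \<alpha> X Y"
    and G_open: "\<And>x. x \<in> G \<Longrightarrow> openin (topology_generated_by \<B>) {f \<in> X. \<pi> (\<alpha> f) x}"
    and \<B>: "\<And>U. U \<in> \<B> \<Longrightarrow> \<exists>x\<in>subframe F hull G. U = {f \<in> X. \<pi> (\<alpha> f) x}"
  shows "homeomorphic_map (topology_generated_by \<B>)
    (topology (\<lambda>U. \<exists>x\<in>subframe F hull G. U = {g \<in> Y. \<pi> g x})) \<alpha>"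
proof -
  let ?S = "subframe F hull G" and ?T = "topology_generated_by \<B>"
  let ?T' = "topology (\<lambda>U. \<exists>x\<in>?S. U = {g \<in> Y. \<pi> g x})"
  note S = subframe_hull[OF F G]
  note hom' = hom[unfolded generated_subframe_def]
  note spec = spectrum_Sup[of F ?S Y \<pi>, OF F S hom'] spectrum_top[of F ?S Y \<pi>, OF F S hom']
    spectrum_meet[of F ?S Y \<pi>, OF F S hom']
  have top': "topspace ?T' = Y" by (rule topspace_spectrum[OF F S hom'])
  have open': "openin ?T' U \<longleftrightarrow> (\<exists>x\<in>?S. U = {g \<in> Y. \<pi> g x})" for U
    by (rule openin_spectrum[OF F S hom'])
  have \<alpha>: "\<alpha> f \<in> Y" if "f \<in> X" for f using bij_betwE[OF bij] that by blast
  have topX: "topspace ?T = X" by (simp add: X topology_generated_by_topspace)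
  let ?W = "\<lambda>x. {f \<in> X. \<pi> (\<alpha> f) x}"
  have "subframe F {x \<in> ?S. openin ?T (?W x)}"
    unfolding subframe_def[of F "{x \<in> ?S. openin ?T (?W x)}"]
  proof (intro conjI allI impI ballI)
    show "{x \<in> ?S. openin ?T (?W x)} \<subseteq> carrier F" using S by (auto simp: subframe_def)
    show "\<Squnion>\<^bsub>F\<^esub> A \<in> {x \<in> ?S. openin ?T (?W x)}" if A: "A \<subseteq> {x \<in> ?S. openin ?T (?W x)}" for A
    proof -
      have "A \<subseteq> ?S" using A by auto
      then have "?W (\<Squnion>\<^bsub>F\<^esub> A) = (\<Union>x\<in>A. ?W x)" by (auto simp: spec(1) \<alpha>)
      moreover have "openin ?T (\<Union>x\<in>A. ?W x)" using A by (intro openin_Union) auto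
      ultimately show ?thesis using S \<open>A \<subseteq> ?S\<close> by (simp add: subframe_def)
    qed
    have "?W \<top>\<^bsub>F\<^esub> = topspace ?T" unfolding topX using \<alpha> spec(2) by auto
    then show "\<top>\<^bsub>F\<^esub> \<in> {x \<in> ?S. openin ?T (?W x)}"
      using S openin_topspace[of ?T] by (simp add: subframe_def)
    show "x \<sqinter>\<^bsub>F\<^esub> y \<in> {x \<in> ?S. openin ?T (?W x)}"
      if "x \<in> {x \<in> ?S. openin ?T (?W x)}" "y \<in> {x \<in> ?S. openin ?T (?W x)}" for x y
    proof -
      have "?W (x \<sqinter>\<^bsub>F\<^esub> y) = ?W x \<inter> ?W y" using that by (auto simp: spec(3) \<alpha>)
      then show ?thesis using that S by (simp add: subframe_def openin_Int)
    qed
  qed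
  moreover have "G \<subseteq> {x \<in> ?S. openin ?T (?W x)}"
    using G_open hull_subset[of G "subframe F"] by auto
  ultimately have "?S \<subseteq> {x \<in> ?S. openin ?T (?W x)}" by (rule hull_minimal[rotated])
  then have W: "openin ?T (?W x)" if "x \<in> ?S" for x using that by blast
  let ?\<beta> = "inv_into X \<alpha>"
  have \<beta>: "?\<beta> g \<in> X" "\<alpha> (?\<beta> g) = g" if "g \<in> Y" for g
    using bij that by (auto simp: bij_betw_def inv_into_into f_inv_into_f)
  have "continuous_map ?T ?T' \<alpha>"
    unfolding continuous_map_def
  proof (intro conjI allI impI)
    show "\<alpha> \<in> topspace ?T \<rightarrow> topspace ?T'"
      unfolding top' topX using \<alpha> by simp
    fix U assume "openin ?T' U"
    then obtain x where x: "x \<in> ?S" "U = {g \<in> Y. \<pi> g x}" by (auto simp: open')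
    then have "{f \<in> topspace ?T. \<alpha> f \<in> U} = ?W x" unfolding topX using \<alpha> by auto
    then show "openin ?T {f \<in> topspace ?T. \<alpha> f \<in> U}" using W[OF x(1)] by simp
  qed
  moreover have "continuous_map ?T' ?T ?\<beta>"
  proof (rule continuous_on_generated_topo)
    fix U assume "U \<in> \<B>"
    then obtain x where x: "x \<in> ?S" "U = ?W x" using \<B> by blast
    then have "?\<beta> -` U \<inter> topspace ?T' = {g \<in> Y. \<pi> g x}"
      using \<beta> by (auto simp: top')
    then show "openin ?T' (?\<beta> -` U \<inter> topspace ?T')"
      using x(1) by (simp only: open') (rule bexI, rule refl)
  next
    show "?\<beta> ` topspace ?T' \<subseteq> \<Union>\<B>" unfolding top' X[symmetric] using \<beta>(1) by blast
  qed
  moreover have "?\<beta> (\<alpha> f) = f" if "f \<in> X" for f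
    using bij that by (simp add: bij_betw_def)
  ultimately have "homeomorphic_maps ?T ?T' \<alpha> ?\<beta>"
    using \<beta>(2) unfolding homeomorphic_maps_def top' topX by blast
  then show ?thesis by (rule homeomorphic_maps_imp_map)
qed

text \<open>With \<open>i\<close> for \<open>nabla\<close> and \<open>j\<close> for
  \<open>delta\<close>, the generators name exactly the opens of \<open>S\<close> and the
  complements of opens of \<open>T\<close>. Keeping \<open>S\<close> and \<open>T\<close> abstract
  lets the positive and negative cases differ only by exchanging them.\<close>

lemma homeomorphic_map_Skula_spectrum:
  fixes F :: "'a gorder" and \<pi> :: "'g \<Rightarrow> 'a \<Rightarrow> bool"
  assumes F: "complete_lattice F" and G: "i ` A \<union> j ` B \<subseteq> carrier F"
    and hom: "\<And>g. g \<in> Y \<Longrightarrow> frame_map (generated_subframe F (i ` A \<union> j ` B)) two (\<pi> g)"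
    and bij: "bij_betw \<alpha> X Y"
    and S: "\<And>U. openin S U \<longleftrightarrow> (\<exists>a\<in>A. U = {f \<in> X. p f a})"
    and T: "\<And>U. openin T U \<longleftrightarrow> (\<exists>b\<in>B. U = {f \<in> X. q f b})"
    and top: "topspace S = X" "topspace T = X"
    and i: "\<And>f a. f \<in> X \<Longrightarrow> a \<in> A \<Longrightarrow> \<pi> (\<alpha> f) (i a) \<longleftrightarrow> p f a"
    and j: "\<And>f b. f \<in> X \<Longrightarrow> b \<in> B \<Longrightarrow> \<pi> (\<alpha> f) (j b) \<longleftrightarrow> \<not> q f b"
  shows "homeomorphic_map (topology_generated_by ({U. openin S U} \<union> {K. closedin T K}))
    (topology (\<lambda>U. \<exists>x\<in>subframe F hull (i ` A \<union> j ` B). U = {g \<in> Y. \<pi> g x})) \<alpha>"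
proof (rule homeomorphic_map_spectrum[OF F G hom _ bij])
  let ?B = "{U. openin S U} \<union> {K. closedin T K}"
  have i': "{f \<in> X. \<pi> (\<alpha> f) (i a)} = {f \<in> X. p f a}" if "a \<in> A" for a
    using that i by auto
  have j': "{f \<in> X. \<pi> (\<alpha> f) (j b)} = X - {f \<in> X. q f b}" if "b \<in> B" for b
    using that j by auto
  show "X = \<Union>?B"
  proof
    show "X \<subseteq> \<Union>?B" using openin_topspace[of S] top(1) by (intro Union_upper) simp
    show "\<Union>?B \<subseteq> X" using openin_subset[of S] closedin_subset[of T] top by (intro Union_least) auto
  qed
  show "openin (topology_generated_by ?B) {f \<in> X. \<pi> (\<alpha> f) x}" if "x \<in> i ` A \<union> j ` B" for x
  proof (rule topology_generated_by_Basis)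
    from that consider a where "a \<in> A" "x = i a" | b where "b \<in> B" "x = j b" by blast
    then show "{f \<in> X. \<pi> (\<alpha> f) x} \<in> ?B"
    proof cases
      case 1
      then show ?thesis using S by (auto simp: i')
    next
      case 2
      then have "openin T {f \<in> X. q f b}" using T by blast
      then have "closedin T (topspace T - {f \<in> X. q f b})" by (rule closedin_diff[OF closedin_topspace])
      then show ?thesis using 2 by (simp add: j' top)
    qed
  qed
  show "\<exists>x\<in>subframe F hull (i ` A \<union> j ` B). U = {f \<in> X. \<pi> (\<alpha> f) x}" if "U \<in> ?B" for U
  proof -
    from that consider "openin S U" | "closedin T U" by blast
    then obtain x where "x \<in> i ` A \<union> j ` B" "U = {f \<in> X. \<pi> (\<alpha> f) x}"
    proof cases
      case 1
      then obtain a where "a \<in> A" "U = {f \<in> X. p f a}" using S by blast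
      then show ?thesis using that[of "i a"] by (simp add: i')
    next
      case 2
      then have U: "U \<subseteq> X" "openin T (X - U)" by (simp_all add: closedin_def top)
      then obtain b where b: "b \<in> B" "X - U = {f \<in> X. q f b}" using T by blast
      have "U = X - (X - U)" using U(1) by blast
      also have "\<dots> = {f \<in> X. \<pi> (\<alpha> f) (j b)}" by (simp only: b(2) j'[OF b(1)])
      finally show ?thesis using that[of "j b"] b(1) by simp
    qed
    then show ?thesis by (intro bexI[of _ x]) (simp_all add: hull_inc)
  qed
qed

section \<open>Points of the assembly\<close>

lemma carrier_generated_subframe [simp]: "carrier (generated_subframe F G) = subframe F hull G"
  by (simp add: generated_subframe_def)

locale biframe_spectrum =
  fixes L :: "('p, 'n, 'a) biframe"
  assumes is_biframe: "is_biframe L"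
begin

sublocale P: frame "Pos L"
  using is_biframe by (simp add: is_biframe_def)

sublocale N: frame "Neg L"
  using is_biframe by (simp add: is_biframe_def)

sublocale M: gorder_frame "Main L"
  using is_biframe by (simp add: is_biframe_def gorder_frame_def)

section \<open>The generators of the three components of the assembly\<close>

abbreviation "C \<equiv> congruence_frame (Main L)"

abbreviation "pos_generators \<equiv>
  nabla (Main L) ` emb_pos L ` carrier (Pos L) \<union> delta (Main L) ` emb_neg L ` carrier (Neg L)"

abbreviation "neg_generators \<equiv>
  nabla (Main L) ` emb_neg L ` carrier (Neg L) \<union> delta (Main L) ` emb_pos L ` carrier (Pos L)"

abbreviation "main_generators \<equiv>
  nabla (Main L) ` carrier (Main L) \<union> delta (Main L) ` fin_elements L"

lemma assembly_simps:
  "Pos (assembly L) = generated_subframe C pos_generators"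
  "Neg (assembly L) = generated_subframe C neg_generators"
  "Main (assembly L) = generated_subframe C main_generators"
  "emb_pos (assembly L) = id" "emb_neg (assembly L) = id"
  by (simp_all add: assembly_def Let_def)

lemma emb_frame_map:
  "frame_map (Pos L) (Main L) (emb_pos L)" "frame_map (Neg L) (Main L) (emb_neg L)"
  using is_biframe by (simp_all add: is_biframe_def)

lemma emb_closed:
  "a \<in> carrier (Pos L) \<Longrightarrow> emb_pos L a \<in> carrier (Main L)"
  "b \<in> carrier (Neg L) \<Longrightarrow> emb_neg L b \<in> carrier (Main L)"
  using emb_frame_map by (auto simp: frame_map_def)

lemma rectangles_subset: "rectangles L \<subseteq> carrier (Main L)"
  using emb_closed by (auto simp: rectangles_def)

lemma fin_elements_subset: "fin_elements L \<subseteq> carrier (Main L)"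
  using rectangles_subset by (auto simp: fin_elements_def intro!: M.sup_closed)

lemma rectangle_fin:
  assumes "z \<in> rectangles L"
  shows "z \<in> fin_elements L"
proof -
  have "\<Squnion>\<^bsub>Main L\<^esub> {z} = z" using assms rectangles_subset by auto
  then show ?thesis
    unfolding fin_elements_def using assms by (intro CollectI exI[of _ "{z}"]) simp
qed

text \<open>A positive element is the rectangle formed with the negative top. This places its
  \<open>delta\<close> in the main component, next to its complement.\<close>

lemma emb_pos_fin:
  assumes "a \<in> carrier (Pos L)"
  shows "emb_pos L a \<in> fin_elements L"
proof -
  have "emb_pos L a \<sqinter>\<^bsub>Main L\<^esub> emb_neg L \<top>\<^bsub>Neg L\<^esub> = emb_pos L a"
    using emb_frame_map(2) M.top_meet_eq[OF emb_closed(1)[OF assms]]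
    by (simp add: frame_map_def meet_comm[of "Main L" "emb_pos L a"])
  moreover have "emb_pos L a \<sqinter>\<^bsub>Main L\<^esub> emb_neg L \<top>\<^bsub>Neg L\<^esub> \<in> rectangles L"
    using assms N.top_closed by (auto simp: rectangles_def)
  ultimately show ?thesis by (simp add: rectangle_fin)
qed

lemma emb_neg_fin:
  assumes "b \<in> carrier (Neg L)"
  shows "emb_neg L b \<in> fin_elements L"
proof -
  have "emb_pos L \<top>\<^bsub>Pos L\<^esub> \<sqinter>\<^bsub>Main L\<^esub> emb_neg L b = emb_neg L b"
    using emb_frame_map(1) M.top_meet_eq[OF emb_closed(2)[OF assms]]
    by (simp add: frame_map_def)
  moreover have "emb_pos L \<top>\<^bsub>Pos L\<^esub> \<sqinter>\<^bsub>Main L\<^esub> emb_neg L b \<in> rectangles L"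
    using assms P.top_closed by (auto simp: rectangles_def)
  ultimately show ?thesis by (simp add: rectangle_fin)
qed

lemma main_generators_subset: "main_generators \<subseteq> carrier C"
  using fin_elements_subset by (auto intro!: M.congruence_nabla M.congruence_delta)

lemma pos_generators_subset: "pos_generators \<subseteq> main_generators"
  using emb_closed emb_neg_fin by auto

lemma neg_generators_subset: "neg_generators \<subseteq> main_generators"
  using emb_closed emb_pos_fin by auto

lemmas generators_subset =
  order_trans[OF pos_generators_subset main_generators_subset]
  order_trans[OF neg_generators_subset main_generators_subset]
  main_generators_subset

lemma generatorsI:
  "a \<in> carrier (Pos L) \<Longrightarrow> nabla (Main L) (emb_pos L a) \<in> subframe C hull pos_generators"
  "b \<in> carrier (Neg L) \<Longrightarrow> delta (Main L) (emb_neg L b) \<in> subframe C hull pos_generators"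
  "b \<in> carrier (Neg L) \<Longrightarrow> nabla (Main L) (emb_neg L b) \<in> subframe C hull neg_generators"
  "a \<in> carrier (Pos L) \<Longrightarrow> delta (Main L) (emb_pos L a) \<in> subframe C hull neg_generators"
  "x \<in> carrier (Main L) \<Longrightarrow> nabla (Main L) x \<in> subframe C hull main_generators"
  "s \<in> fin_elements L \<Longrightarrow> delta (Main L) s \<in> subframe C hull main_generators"
  by (intro hull_inc; simp)+

lemmas frame_map_generated_two =
  frame_map_subframe_two[OF M.complete_lattice_congruence_frame
    subframe_hull[OF M.complete_lattice_congruence_frame], folded generated_subframe_def]

section \<open>Values on complementary generators, and uniqueness of extensions\<close>

lemma biframe_maps_two_iff:
  "f \<in> biframe_maps K two_biframe \<longleftrightarrow>
     frame_map (Pos K) two (fst f) \<and> fst f \<in> extensional (carrier (Pos K)) \<and>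
     frame_map (Neg K) two (snd f) \<and> snd f \<in> extensional (carrier (Neg K)) \<and>
     (\<exists>h. frame_map (Main K) two h \<and>
        (\<forall>a \<in> carrier (Pos K). h (emb_pos K a) = fst f a) \<and>
        (\<forall>b \<in> carrier (Neg K). h (emb_neg K b) = snd f b))"
  by (cases f) (simp add: biframe_maps_def two_biframe_def)

text \<open>A point sends complements to opposite truth values. The main component is used because
  it contains both members of the pair.\<close>

lemma delta_iff_not_nabla:
  assumes h: "frame_map (Main (assembly L)) two h" and s: "s \<in> fin_elements L"
  shows "h (delta (Main L) s) \<longleftrightarrow> \<not> h (nabla (Main L) s)"
proof -
  have s': "s \<in> carrier (Main L)" using s fin_elements_subset by blast
  note h' = h[unfolded assembly_simps frame_map_generated_two[OF main_generators_subset]]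
  have mem: "nabla (Main L) s \<in> subframe C hull main_generators"
    "delta (Main L) s \<in> subframe C hull main_generators"
    by (simp_all only: generatorsI s s')
  have "h (\<Squnion>\<^bsub>C\<^esub> {nabla (Main L) s, delta (Main L) s})"
    using h' by (simp only: M.nabla_join_delta[OF s'])
  then have "h (nabla (Main L) s) \<or> h (delta (Main L) s)"
    using h' mem by (metis (no_types, lifting) empty_subsetI insertE insert_subset singletonD)
  moreover have "\<not> h (\<Squnion>\<^bsub>C\<^esub> {})" using h' by (metis empty_iff empty_subsetI)
  then have "\<not> (h (nabla (Main L) s) \<and> h (delta (Main L) s))"
    using h' mem M.nabla_meet_delta[OF s'] by metis
  ultimately show ?thesis by blast
qed

lemma biframe_comp_nabla_map:
  "a \<in> carrier (Pos L) \<Longrightarrow> fst (biframe_comp L g (nabla_map L)) a = fst g (nabla (Main L) (emb_pos L a))"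
  "b \<in> carrier (Neg L) \<Longrightarrow> snd (biframe_comp L g (nabla_map L)) b = snd g (nabla (Main L) (emb_neg L b))"
  "fst (biframe_comp L g (nabla_map L)) \<in> extensional (carrier (Pos L))"
  "snd (biframe_comp L g (nabla_map L)) \<in> extensional (carrier (Neg L))"
  by (simp_all add: biframe_comp_def nabla_map_def compose_eq)

text \<open>The main map carries the value across the sides: \<open>fst g\<close> at a
  \<open>delta\<close> is the value of \<open>h\<close> there, which negates \<open>h\<close> at the
  corresponding \<open>nabla\<close>, where \<open>h\<close> agrees with \<open>snd g\<close>. The
  other half is symmetric.\<close>

lemma assembly_point_delta:
  assumes g: "g \<in> biframe_maps (assembly L) two_biframe"
  shows "b \<in> carrier (Neg L) \<Longrightarrow>
      fst g (delta (Main L) (emb_neg L b)) \<longleftrightarrow> \<not> snd (biframe_comp L g (nabla_map L)) b"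
    and "a \<in> carrier (Pos L) \<Longrightarrow>
      snd g (delta (Main L) (emb_pos L a)) \<longleftrightarrow> \<not> fst (biframe_comp L g (nabla_map L)) a"
proof -
  obtain h where h: "frame_map (Main (assembly L)) two h"
    and pos: "\<And>\<theta>. \<theta> \<in> subframe C hull pos_generators \<Longrightarrow> h \<theta> = fst g \<theta>"
    and neg: "\<And>\<theta>. \<theta> \<in> subframe C hull neg_generators \<Longrightarrow> h \<theta> = snd g \<theta>"
    using g unfolding biframe_maps_two_iff assembly_simps id_apply carrier_generated_subframe by metis
  show "fst g (delta (Main L) (emb_neg L b)) \<longleftrightarrow> \<not> snd (biframe_comp L g (nabla_map L)) b"
    if b: "b \<in> carrier (Neg L)" for b
    using delta_iff_not_nabla[OF h emb_neg_fin[OF b]] pos[OF generatorsI(2)[OF b]]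
      neg[OF generatorsI(3)[OF b]] biframe_comp_nabla_map(2)[OF b, of g] by metis
  show "snd g (delta (Main L) (emb_pos L a)) \<longleftrightarrow> \<not> fst (biframe_comp L g (nabla_map L)) a"
    if a: "a \<in> carrier (Pos L)" for a
    using delta_iff_not_nabla[OF h emb_pos_fin[OF a]] neg[OF generatorsI(4)[OF a]]
      pos[OF generatorsI(1)[OF a]] biframe_comp_nabla_map(1)[OF a, of g] by metis
qed

lemma assembly_point_eqI:
  assumes g: "g \<in> biframe_maps (assembly L) two_biframe"
    and g': "g' \<in> biframe_maps (assembly L) two_biframe"
    and eq: "biframe_comp L g (nabla_map L) = biframe_comp L g' (nabla_map L)"
  shows "g = g'"
proof (rule prod_eqI)
  note C = M.complete_lattice_congruence_frame
  note pts = g[unfolded biframe_maps_two_iff assembly_simps carrier_generated_subframe]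
    g'[unfolded biframe_maps_two_iff assembly_simps carrier_generated_subframe]
  have nab: "fst g (nabla (Main L) (emb_pos L a)) = fst g' (nabla (Main L) (emb_pos L a))"
    if "a \<in> carrier (Pos L)" for a
    using biframe_comp_nabla_map(1)[OF that, of g] biframe_comp_nabla_map(1)[OF that, of g'] eq by simp
  have nab': "snd g (nabla (Main L) (emb_neg L b)) = snd g' (nabla (Main L) (emb_neg L b))"
    if "b \<in> carrier (Neg L)" for b
    using biframe_comp_nabla_map(2)[OF that, of g] biframe_comp_nabla_map(2)[OF that, of g'] eq by simp
  show "fst g = fst g'"
  proof (rule extensionalityI)
    show "fst g \<in> extensional (subframe C hull pos_generators)"
      "fst g' \<in> extensional (subframe C hull pos_generators)" using pts by blast+
    show "fst g \<theta> = fst g' \<theta>" if "\<theta> \<in> subframe C hull pos_generators" for \<theta>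
    proof (rule points_eq_on_hull[OF C generators_subset(1) _ _ _ that])
      show "frame_map (generated_subframe C pos_generators) two (fst g)"
        "frame_map (generated_subframe C pos_generators) two (fst g')" using pts by blast+
      fix \<phi> assume "\<phi> \<in> pos_generators"
      then show "fst g \<phi> = fst g' \<phi>"
        using nab assembly_point_delta(1)[OF g] assembly_point_delta(1)[OF g'] eq by auto
    qed
  qed
  show "snd g = snd g'"
  proof (rule extensionalityI)
    show "snd g \<in> extensional (subframe C hull neg_generators)"
      "snd g' \<in> extensional (subframe C hull neg_generators)" using pts by blast+
    show "snd g \<theta> = snd g' \<theta>" if "\<theta> \<in> subframe C hull neg_generators" for \<theta>
    proof (rule points_eq_on_hull[OF C generators_subset(2) _ _ _ that])
      show "frame_map (generated_subframe C neg_generators) two (snd g)"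
        "frame_map (generated_subframe C neg_generators) two (snd g')" using pts by blast+
      fix \<phi> assume "\<phi> \<in> neg_generators"
      then show "snd g \<phi> = snd g' \<phi>"
        using nab' assembly_point_delta(2)[OF g] assembly_point_delta(2)[OF g'] eq by auto
    qed
  qed
qed

section \<open>Existence of extensions and bijectivity of \<open>alpha\<close>\<close>

lemma frame_map_separates:
  assumes h: "frame_map (Main L) two h" and G: "G \<subseteq> carrier C"
  shows "frame_map (generated_subframe C G) two (separates h)"
  unfolding frame_map_generated_two[OF G]
proof (intro conjI allI impI ballI)
  have c: "congruence (Main L) \<theta>" if "\<theta> \<in> subframe C hull G" for \<theta>
    using that subframe_hull[OF M.complete_lattice_congruence_frame G] by (auto simp: subframe_def)
  show "separates h (\<Squnion>\<^bsub>C\<^esub> T) \<longleftrightarrow> (\<exists>\<theta>\<in>T. separates h \<theta>)" if "T \<subseteq> subframe C hull G" for T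
    using that c by (intro M.separates_Sup[OF h]) auto
  show "separates h \<top>\<^bsub>C\<^esub>" using M.separates_total[OF h] by simp
  show "separates h (\<theta> \<sqinter>\<^bsub>C\<^esub> \<phi>) \<longleftrightarrow> separates h \<theta> \<and> separates h \<phi>"
    if "\<theta> \<in> subframe C hull G" "\<phi> \<in> subframe C hull G" for \<theta> \<phi>
    using that by (simp add: c M.separates_Int[OF h])
qed

lemma assembly_point_exists:
  assumes f: "f \<in> biframe_maps L two_biframe"
  shows "\<exists>g \<in> biframe_maps (assembly L) two_biframe. biframe_comp L g (nabla_map L) = f"
proof -
  note f' = f[unfolded biframe_maps_two_iff]
  then obtain h where h: "frame_map (Main L) two h"
    and pos: "\<And>a. a \<in> carrier (Pos L) \<Longrightarrow> h (emb_pos L a) = fst f a"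
    and neg: "\<And>b. b \<in> carrier (Neg L) \<Longrightarrow> h (emb_neg L b) = snd f b"
    by blast
  \<comment> \<open>Both sides are the same predicate, so \<open>separates h\<close> itself serves
    as the main map; the restrictions only provide extensionality.\<close>
  define g where "g = (restrict (separates h) (subframe C hull pos_generators),
    restrict (separates h) (subframe C hull neg_generators))"
  have fr: "frame_map (generated_subframe C G) two (restrict (separates h) (subframe C hull G))"
    if G: "G \<subseteq> carrier C" for G
  proof -
    note sep = frame_map_separates[OF h G, unfolded frame_map_generated_two[OF G]]
    \<comment> \<open>The hull is closed under the frame operations, so restriction changes no value
      that the conditions mention.\<close>
    have "subframe C (subframe C hull G)"
      by (rule subframe_hull[OF M.complete_lattice_congruence_frame G])
    then show ?thesis
      unfolding frame_map_generated_two[OF G] using sep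
      by (simp add: subframe_def subset_iff del: M.meet_congruence_frame)
  qed
  have "g \<in> biframe_maps (assembly L) two_biframe"
    unfolding biframe_maps_two_iff assembly_simps carrier_generated_subframe id_apply
    using fr[OF generators_subset(1)] fr[OF generators_subset(2)]
      frame_map_separates[OF h main_generators_subset]
    by (intro conjI exI[of _ "separates h"]) (simp_all add: g_def)
  moreover have "biframe_comp L g (nabla_map L) = f"
  proof (rule prod_eqI; rule extensionalityI)
    show "fst (biframe_comp L g (nabla_map L)) a = fst f a" if "a \<in> carrier (Pos L)" for a
      using that M.separates_nabla[OF h emb_closed(1)]
      by (simp add: biframe_comp_nabla_map g_def generatorsI pos)
    show "snd (biframe_comp L g (nabla_map L)) b = snd f b" if "b \<in> carrier (Neg L)" for b
      using that M.separates_nabla[OF h emb_closed(2)]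
      by (simp add: biframe_comp_nabla_map g_def generatorsI neg)
  qed (use f' biframe_comp_nabla_map(3,4) in blast)+
  ultimately show ?thesis by blast
qed

text \<open>The inverse of \<open>alpha\<close> must land in the points of \<open>L\<close>. The
  main map of the composite is the main map of \<open>g\<close> after \<open>nabla\<close> on all of
  \<open>Main L\<close>; its two sides are then restrictions along the embeddings.\<close>

lemma biframe_comp_closed:
  assumes g: "g \<in> biframe_maps (assembly L) two_biframe"
  shows "biframe_comp L g (nabla_map L) \<in> biframe_maps L two_biframe"
proof -
  obtain h where h: "frame_map (Main (assembly L)) two h"
    and pos: "\<And>\<theta>. \<theta> \<in> subframe C hull pos_generators \<Longrightarrow> h \<theta> = fst g \<theta>"
    and neg: "\<And>\<theta>. \<theta> \<in> subframe C hull neg_generators \<Longrightarrow> h \<theta> = snd g \<theta>"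
    using g unfolding biframe_maps_two_iff assembly_simps id_apply carrier_generated_subframe by metis
  note h' = h[unfolded assembly_simps frame_map_generated_two[OF main_generators_subset]]
  let ?k = "\<lambda>x. h (nabla (Main L) x)"
  have k: "frame_map (Main L) two ?k"
    unfolding frame_map_two
  proof (intro conjI allI impI ballI)
    show "?k (\<Squnion>\<^bsub>Main L\<^esub> S) \<longleftrightarrow> (\<exists>x\<in>S. ?k x)" if S: "S \<subseteq> carrier (Main L)" for S
    proof -
      have "nabla (Main L) ` S \<subseteq> subframe C hull main_generators"
        using S generatorsI(5) by blast
      then have "h (\<Squnion>\<^bsub>C\<^esub> (nabla (Main L) ` S)) \<longleftrightarrow> (\<exists>\<theta>\<in>nabla (Main L) ` S. h \<theta>)"
        using h' by blast
      then show ?thesis by (simp add: M.nabla_Sup[OF S])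
    qed
    show "?k \<top>\<^bsub>Main L\<^esub>" using h' by (simp add: M.nabla_top)
    show "?k (x \<sqinter>\<^bsub>Main L\<^esub> y) \<longleftrightarrow> ?k x \<and> ?k y"
      if xy: "x \<in> carrier (Main L)" "y \<in> carrier (Main L)" for x y
      using h' generatorsI(5)[OF xy(1)] generatorsI(5)[OF xy(2)]
      unfolding M.nabla_meet[OF xy] by blast
  qed
  have ke: "?k (emb_pos L a) = fst (biframe_comp L g (nabla_map L)) a" if "a \<in> carrier (Pos L)" for a
    using pos[OF generatorsI(1)[OF that]] biframe_comp_nabla_map(1)[OF that, of g] by simp
  have ke': "?k (emb_neg L b) = snd (biframe_comp L g (nabla_map L)) b" if "b \<in> carrier (Neg L)" for b
    using neg[OF generatorsI(3)[OF that]] biframe_comp_nabla_map(2)[OF that, of g] by simp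
  have "frame_map (Pos L) two (\<lambda>a. ?k (emb_pos L a)) \<longleftrightarrow>
      frame_map (Pos L) two (fst (biframe_comp L g (nabla_map L)))"
    by (rule frame_map_cong[OF P.frame_axioms ke])
  then have "frame_map (Pos L) two (fst (biframe_comp L g (nabla_map L)))"
    using frame_map_comp[OF emb_frame_map(1) k] by (rule iffD1)
  moreover have "frame_map (Neg L) two (\<lambda>b. ?k (emb_neg L b)) \<longleftrightarrow>
      frame_map (Neg L) two (snd (biframe_comp L g (nabla_map L)))"
    by (rule frame_map_cong[OF N.frame_axioms ke'])
  then have "frame_map (Neg L) two (snd (biframe_comp L g (nabla_map L)))"
    using frame_map_comp[OF emb_frame_map(2) k] by (rule iffD1)
  ultimately show ?thesis
    unfolding biframe_maps_two_iff using k ke ke' biframe_comp_nabla_map(3,4) by blast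
qed

lemma alpha_point:
  assumes "f \<in> biframe_maps L two_biframe"
  shows "alpha L f \<in> biframe_maps (assembly L) two_biframe"
    and "biframe_comp L (alpha L f) (nabla_map L) = f"
proof -
  have "\<exists>!g. g \<in> biframe_maps (assembly L) two_biframe \<and> biframe_comp L g (nabla_map L) = f"
    using assembly_point_exists[OF assms] assembly_point_eqI by blast
  from theI'[OF this]
  show "alpha L f \<in> biframe_maps (assembly L) two_biframe"
    and "biframe_comp L (alpha L f) (nabla_map L) = f"
    unfolding alpha_def by blast+
qed

lemma bij_betw_alpha:
  "bij_betw (alpha L) (biframe_maps L two_biframe) (biframe_maps (assembly L) two_biframe)"
  by (rule bij_betw_byWitness[where f' = "\<lambda>g. biframe_comp L g (nabla_map L)"])
    (auto simp: alpha_point biframe_comp_closed intro!: assembly_point_eqI)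

text \<open>These four equivalences are the hypotheses \<open>i\<close> and \<open>j\<close> of
  \<open>homeomorphic_map_Skula_spectrum\<close> for the two topologies.\<close>

lemma alpha_generators:
  assumes f: "f \<in> biframe_maps L two_biframe"
  shows "a \<in> carrier (Pos L) \<Longrightarrow> fst (alpha L f) (nabla (Main L) (emb_pos L a)) \<longleftrightarrow> fst f a"
    and "b \<in> carrier (Neg L) \<Longrightarrow> fst (alpha L f) (delta (Main L) (emb_neg L b)) \<longleftrightarrow> \<not> snd f b"
    and "b \<in> carrier (Neg L) \<Longrightarrow> snd (alpha L f) (nabla (Main L) (emb_neg L b)) \<longleftrightarrow> snd f b"
    and "a \<in> carrier (Pos L) \<Longrightarrow> snd (alpha L f) (delta (Main L) (emb_pos L a)) \<longleftrightarrow> \<not> fst f a"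
  using assembly_point_delta[OF alpha_point(1)[OF f]] biframe_comp_nabla_map(1,2)[where g = "alpha L f"]
  by (simp_all add: alpha_point(2)[OF f])

section \<open>Comparing the Skula topologies with the spectra of the assembly\<close>

lemma openin_bpt':
  "openin (pos_top (bpt L)) U \<longleftrightarrow>
     (\<exists>a\<in>carrier (Pos L). U = {f \<in> biframe_maps L two_biframe. fst f a})"
  "openin (neg_top (bpt L)) U \<longleftrightarrow>
     (\<exists>b\<in>carrier (Neg L). U = {f \<in> biframe_maps L two_biframe. snd f b})"
  using openin_bpt[OF is_biframe] by (simp_all add: bpt_def Let_def)

lemma topspace_bpt:
  "topspace (pos_top (bpt L)) = biframe_maps L two_biframe"
  "topspace (neg_top (bpt L)) = biframe_maps L two_biframe"
  using is_bispace_bpt[OF is_biframe] by (simp_all add: is_bispace_def bpt_def Let_def)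

lemma homeomorphic_map_alpha_pos:
  "homeomorphic_map (pos_top (Skula (bpt L))) (pos_top (bpt (assembly L))) (alpha L)"
proof -
  have "homeomorphic_map
      (topology_generated_by ({U. openin (pos_top (bpt L)) U} \<union> {K. closedin (neg_top (bpt L)) K}))
      (topology (\<lambda>U. \<exists>\<theta>\<in>subframe C hull pos_generators.
        U = {g \<in> biframe_maps (assembly L) two_biframe. fst g \<theta>})) (alpha L)"
    \<comment> \<open>The generators are images of images; fusing them exposes one function on each
      side's carrier, the shape that the general lemma expects.\<close>
    unfolding image_image
  proof (rule homeomorphic_map_Skula_spectrum[OF M.complete_lattice_congruence_frame _ _
        bij_betw_alpha openin_bpt'(1) openin_bpt'(2) topspace_bpt])
    show "(\<lambda>a. nabla (Main L) (emb_pos L a)) ` carrier (Pos L) \<union>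
        (\<lambda>b. delta (Main L) (emb_neg L b)) ` carrier (Neg L) \<subseteq> carrier C"
      using generators_subset(1) by (simp only: image_image)
    show "frame_map (generated_subframe C ((\<lambda>a. nabla (Main L) (emb_pos L a)) ` carrier (Pos L) \<union>
        (\<lambda>b. delta (Main L) (emb_neg L b)) ` carrier (Neg L))) two (fst g)"
      if "g \<in> biframe_maps (assembly L) two_biframe" for g
      using that by (simp only: biframe_maps_two_iff assembly_simps image_image)
  qed (fact alpha_generators)+
  then show ?thesis by (simp add: Skula_def bpt_def[of "assembly L"] Let_def assembly_simps)
qed

lemma homeomorphic_map_alpha_neg:
  "homeomorphic_map (neg_top (Skula (bpt L))) (neg_top (bpt (assembly L))) (alpha L)"
proof -
  have "homeomorphic_map
      (topology_generated_by ({U. openin (neg_top (bpt L)) U} \<union> {K. closedin (pos_top (bpt L)) K}))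
      (topology (\<lambda>U. \<exists>\<theta>\<in>subframe C hull neg_generators.
        U = {g \<in> biframe_maps (assembly L) two_biframe. snd g \<theta>})) (alpha L)"
    unfolding image_image
  proof (rule homeomorphic_map_Skula_spectrum[OF M.complete_lattice_congruence_frame _ _
        bij_betw_alpha openin_bpt'(2) openin_bpt'(1) topspace_bpt(2,1)])
    show "(\<lambda>b. nabla (Main L) (emb_neg L b)) ` carrier (Neg L) \<union>
        (\<lambda>a. delta (Main L) (emb_pos L a)) ` carrier (Pos L) \<subseteq> carrier C"
      using generators_subset(2) by (simp only: image_image)
    show "frame_map (generated_subframe C ((\<lambda>b. nabla (Main L) (emb_neg L b)) ` carrier (Neg L) \<union>
        (\<lambda>a. delta (Main L) (emb_pos L a)) ` carrier (Pos L))) two (snd g)"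
      if "g \<in> biframe_maps (assembly L) two_biframe" for g
      using that by (simp only: biframe_maps_two_iff assembly_simps image_image)
  qed (fact alpha_generators)+
  then show ?thesis by (simp add: Skula_def bpt_def[of "assembly L"] Let_def assembly_simps)
qed

end

theorem proposition4p22:
  fixes L :: "('p, 'n, 'a) biframe"
  assumes "is_biframe L"
  shows "bihomeomorphism (Skula (bpt L)) (bpt (assembly L)) (alpha L)"
proof -
  interpret biframe_spectrum L by (rule biframe_spectrum.intro) fact
  have "points (Skula (bpt L)) = biframe_maps L two_biframe"
    "points (bpt (assembly L)) = biframe_maps (assembly L) two_biframe"
    by (simp_all add: Skula_def bpt_def Let_def)
  then show ?thesis
    unfolding bihomeomorphism_def
    using bij_betw_alpha homeomorphic_map_alpha_pos homeomorphic_map_alpha_neg by simp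
qed

end
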